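(* Let $U_A,U_B,U_{A'},U_{B'}$ be cubic-to-orthorhombic martensitic variants such that $U_A,U_B$ have different distinguished axes (so that they can form a Type-II twin) and $U_{A'},U_{B'}$ are the compound counterparts of $U_A,U_B$ respectively. Let rotations $R_{IJ}\in SO(3)$, non-zero vectors $b_{IJ}\in\mathbb{R}^3$ and unit vectors $n_{IJ}\in\mathbb{R}^3$ satisfy $$R_{AB}U_B-U_A=b_{AB}\otimes n_{AB},\qquad R_{A'B'}U_{B'}-U_{A'}=b_{A'B'}\otimes n_{A'B'},$$ $$R_{AA'}U_{A'}-U_A=b_{AA'}\otimes n_{AA'},\qquad R_{BB'}U_{B'}-U_B=b_{BB'}\otimes n_{BB'},$$ where the first two are Type-II twins, $n_{AA'}=n_{BB'}$, and $R_{AB}R_{BB'}=R_{AA'}R_{A'B'}$. For $\lambda,\Lambda\in[0,1]$ let $$M(\lambda,\Lambda)=(1-\Lambda)\big[(1-\lambda)U_A+\lambda R_{AB}U_B\big]+\Lambda R_{AA'}\big[(1-\lambda)U_{A'}+\lambda R_{A'B'}U_{B'}\big],$$ $g(\lambda,\Lambda)=\det(M^TM-\mathbf{1})$, and let $a_0,a_1,a_2,a_3$ be the constants defined in the context. Assume that $a_3\neq0$ and $\frac{a_1}{a_3}\notin[0,\frac14]$ (so that also $a_1\neq0$), and that there is $\lambda^*\in(0,\frac12]$ with $(\lambda^{*})^2-\lambda^*=-\frac{a_0}{a_1}$. Then $g(\lambda,\Lambda)=0$ is equivalent to $$\lambda^2-\lambda=-\frac{a_0+a_2(\Lambda^2-\Lambda)}{a_1+a_3(\Lambda^2-\Lambda)},$$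 and for $\Lambda=0$ and $\Lambda=1$ this equation admits the two solutions $\lambda^*$ and $1-\lambda^*$, so that branches of zeros $(\lambda,\Lambda)$ of $g$ start from $(\lambda^*,0)$ and $(\lambda^*,1)$ and, by the symmetry of $g$, from $(1-\lambda^*,0)$ and $(1-\lambda^*,1)$. Moreover: (i) If $a_0a_3\neq a_1a_2$, then a necessary and sufficient condition for the branches starting from $(\lambda^*,0)$ and $(\lambda^*,1)$ to meet, i.e. for the displayed equation to have solutions $\lambda\in[0,1]$ for all $\Lambda\in[0,1]$, is that $$0\le\frac{4a_0-a_2}{4a_1-a_3}\le\frac14 ,$$ and the condition for the branches starting from $(1-\lambda^*,0)$ and $(1-\lambda^*,1)$ to meet is the same. If, in addition to these conditions, $\frac{4a_0-a_2}{4a_1-a_3}\neq\frac14$, then the solutions are distinct: for every $\Lambda\in[0,1]$ the equation $g(\lambda,\Lambda)=0$ has two distinct solutions $\lambda\in[0,1]$. (ii) If $a_0a_3=a_1a_2$, then $g(\lambda^*,\Lambda)=g(1-\lambda^*,\Lambda)=0$ for all $\Lambda\in[0,1]$.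
   Context: All matrices are real $3\times3$; $\mathbf{1}$ is the identity, $(b\otimes n)_{ij}=b_in_j$, $\mathrm{cof}$ is the cofactor matrix (so $\mathrm{cof}(X)=(\det X)X^{-T}$ for invertible $X$), and for matrices $X\cdot Y=\mathrm{tr}(X^TY)$; for vectors $\cdot$ is the usual dot product. Cubic-to-orthorhombic variants: fix $\alpha,\beta,\gamma>0$ with $\alpha\neq\gamma$ and put $t=\frac{\alpha+\gamma}{2}$, $s=\frac{\alpha-\gamma}{2}$. The six variants are the symmetric positive definite matrices $$U_{1}=\begin{pmatrix}\beta&0&0\\ 0&t&s\\ 0&s&t\end{pmatrix},\quad U_{2}=\begin{pmatrix}\beta&0&0\\ 0&t&-s\\ 0&-s&t\end{pmatrix},\quad U_{3}=\begin{pmatrix}t&0&s\\ 0&\beta&0\\ s&0&t\end{pmatrix},$$ $$U_{4}=\begin{pmatrix}t&0&-s\\ 0&\beta&0\\ -s&0&t\end{pmatrix},\quad U_{5}=\begin{pmatrix}t&s&0\\ s&t&0\\ 0&0&\beta\end{pmatrix},\quad U_{6}=\begin{pmatrix}t&-s&0\\ -s&t&0\\ 0&0&\beta\end{pmatrix}.$$ The distinguished axis of a variant is the coordinate axis carrying the entry $\beta$ in this list ($e_1$ for $U_1,U_2$; $e_2$ for $U_3,U_4$; $e_3$ for $U_5,U_6$). The compound counterpart of a variant is the other variant with the same distinguished axis (pairs $\{U_1,U_2\}$, $\{U_3,U_4\}$, $\{U_5,U_6\}$). Twins: if $U_I,U_J$ are variants with different distinguished axes, there is a unit vector $p$ (unique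 up to sign), of the form $(e_k\pm e_l)/\sqrt2$ with $e_k,e_l$ the two distinguished axes, such that $U_J=PU_IP$ with $P=-\mathbf{1}+2p\otimes p$ (the $180^\circ$ rotation about $p$). A solution of $R\,U_J-U_I=b\otimes n$ with $R\in SO(3)$ and $b,n\neq0$ is called a Type-II twin if $b$ is parallel to $U_Ip$ (the other solution, with $n$ parallel to $p$, is the Type-I twin). Constants: put $\eta=\frac{2}{|b_{AB}|^2}b_{AA'}\cdot b_{AB}$ and $$A_0=U_A^2-\mathbf{1},\quad A_1=U_Ab_{AB}\otimes n_{AB}+n_{AB}\otimes U_A^{-1}b_{AB},\quad A_2=U_Ab_{AA'}\otimes n_{AA'}+n_{AA'}\otimes U_A^{-1}b_{AA'},$$ $$A_3=-\big(U_A^{-1}n_{AB}\cdot b_{AA'}+\eta\big)n_{AA'}\otimes U_A^{-1}b_{AB}-\eta\,U_Ab_{AB}\otimes n_{AA'}.$$ Then $$a_0=\det(U_A^2-\mathbf{1}),\quad a_1=-2\,b_{AB}\cdot U_A\mathrm{cof}(U_A^2-\mathbf{1})n_{AB},\quad a_2=-2\,b_{AA'}\cdot U_A\mathrm{cof}(U_A^2-\mathbf{1})n_{AA'},$$ $$a_3=4\,\mathrm{cof}(A_0+\tfrac12A_2)\cdot(A_1+\tfrac12A_3)+4a_1.$$ The function $g$ then has the form $g(\lambda,\Lambda)=a_0+a_1(\lambda^2-\lambda)+a_2(\Lambda^2-\Lambda)+a_3(\lambda^2-\lambda)(\Lambda^2-\Lambda)$.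
   Formalization: When λ*=1/2 the two solutions at Λ=0,1 coincide and branches may fail to start there; so the existence of starting branches is claimed only for λ*≠1/2, and the two distinct solutions in (i) are claimed except at Λ=0,1 when λ*=1/2. *)

theory Defs
  imports "HOL-Analysis.Analysis"
begin

definition outer :: "real^3 \<Rightarrow> real^3 \<Rightarrow> real^3^3" (infixr "\<odot>" 72) where
  "b \<odot> n = (\<chi> i j. b $ i * n $ j)"

(* The (i,j) cofactor is the determinant of X with its i-th row replaced by the
   j-th unit vector. *)
definition cof :: "real^3^3 \<Rightarrow> real^3^3" where
  "cof X = (\<chi> i j. det (\<chi> k. if k = i then axis j 1 else X $ k))"

subsection \<open>Cubic-to-orthorhombic variants\<close>

datatype variant = V1 | V2 | V3 | V4 | V5 | V6

primrec variant_matrix :: "real \<Rightarrow> real \<Rightarrow> real \<Rightarrow> variant \<Rightarrow> real^3^3" where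
  "variant_matrix \<alpha> \<beta> \<gamma> V1 = (let t = (\<alpha> + \<gamma>) / 2; s = (\<alpha> - \<gamma>) / 2 in
     vector [vector [\<beta>, 0, 0], vector [0, t, s], vector [0, s, t]])"
| "variant_matrix \<alpha> \<beta> \<gamma> V2 = (let t = (\<alpha> + \<gamma>) / 2; s = (\<alpha> - \<gamma>) / 2 in
     vector [vector [\<beta>, 0, 0], vector [0, t, - s], vector [0, - s, t]])"
| "variant_matrix \<alpha> \<beta> \<gamma> V3 = (let t = (\<alpha> + \<gamma>) / 2; s = (\<alpha> - \<gamma>) / 2 in
     vector [vector [t, 0, s], vector [0, \<beta>, 0], vector [s, 0, t]])"
| "variant_matrix \<alpha> \<beta> \<gamma> V4 = (let t = (\<alpha> + \<gamma>) / 2; s = (\<alpha> - \<gamma>) / 2 in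
     vector [vector [t, 0, - s], vector [0, \<beta>, 0], vector [- s, 0, t]])"
| "variant_matrix \<alpha> \<beta> \<gamma> V5 = (let t = (\<alpha> + \<gamma>) / 2; s = (\<alpha> - \<gamma>) / 2 in
     vector [vector [t, s, 0], vector [s, t, 0], vector [0, 0, \<beta>]])"
| "variant_matrix \<alpha> \<beta> \<gamma> V6 = (let t = (\<alpha> + \<gamma>) / 2; s = (\<alpha> - \<gamma>) / 2 in
     vector [vector [t, - s, 0], vector [- s, t, 0], vector [0, 0, \<beta>]])"

primrec distinguished_axis :: "variant \<Rightarrow> 3" where
  "distinguished_axis V1 = 1"
| "distinguished_axis V2 = 1"
| "distinguished_axis V3 = 2"
| "distinguished_axis V4 = 2"
| "distinguished_axis V5 = 3"
| "distinguished_axis V6 = 3"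

definition compound_counterpart :: "variant \<Rightarrow> variant \<Rightarrow> bool" where
  "compound_counterpart I I' \<longleftrightarrow> I' \<noteq> I \<and> distinguished_axis I' = distinguished_axis I"

subsection \<open>Twins\<close>

definition is_twin :: "real^3^3 \<Rightarrow> real^3^3 \<Rightarrow> real^3^3 \<Rightarrow> real^3 \<Rightarrow> real^3 \<Rightarrow> bool" where
  "is_twin UI UJ R b n \<longleftrightarrow>
     rotation_matrix R \<and> b \<noteq> 0 \<and> norm n = 1 \<and> R ** UJ - UI = b \<odot> n"

definition half_turn :: "real^3 \<Rightarrow> real^3^3" where
  "half_turn p = - mat 1 + 2 *\<^sub>R (p \<odot> p)"

(* The explicit form of p matters: for special values of the parameters, such as
   \<beta> = \<alpha>, further half-turns map one variant to the other. *)
definition twin_rotation_axis ::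
  "real \<Rightarrow> real \<Rightarrow> real \<Rightarrow> variant \<Rightarrow> variant \<Rightarrow> real^3 \<Rightarrow> bool" where
  "twin_rotation_axis \<alpha> \<beta> \<gamma> I J p \<longleftrightarrow>
     (let k = distinguished_axis I; l = distinguished_axis J in
        k \<noteq> l \<and>
        (p = (1 / sqrt 2) *\<^sub>R (axis k 1 + axis l 1) \<or>
         p = (1 / sqrt 2) *\<^sub>R (axis k 1 - axis l 1) \<or>
         p = - (1 / sqrt 2) *\<^sub>R (axis k 1 + axis l 1) \<or>
         p = - (1 / sqrt 2) *\<^sub>R (axis k 1 - axis l 1)) \<and>
        variant_matrix \<alpha> \<beta> \<gamma> J = half_turn p ** variant_matrix \<alpha> \<beta> \<gamma> I ** half_turn p)"

definition is_type_II_twin ::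
  "real \<Rightarrow> real \<Rightarrow> real \<Rightarrow> variant \<Rightarrow> variant \<Rightarrow> real^3^3 \<Rightarrow> real^3 \<Rightarrow> real^3 \<Rightarrow> bool" where
  "is_type_II_twin \<alpha> \<beta> \<gamma> I J R b n \<longleftrightarrow>
     is_twin (variant_matrix \<alpha> \<beta> \<gamma> I) (variant_matrix \<alpha> \<beta> \<gamma> J) R b n \<and>
     (\<exists>p. twin_rotation_axis \<alpha> \<beta> \<gamma> I J p \<and>
          (\<exists>c. b = c *\<^sub>R (variant_matrix \<alpha> \<beta> \<gamma> I *v p)))"

subsection \<open>The constants\<close>

(* The arguments are U = U_A, b = b_AB, n = n_AB, b' = b_AA', n' = n_AA'.  In const_a3 the
   inner product of matrices is the one of type real^3^3, which is tr (X^T Y). *)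

definition const_a0 :: "real^3^3 \<Rightarrow> real" where
  "const_a0 U = det (U ** U - mat 1)"

(* a_1 for the pair (b_AB, n_AB), a_2 for the pair (b_AA', n_AA') *)
definition const_a12 :: "real^3^3 \<Rightarrow> real^3 \<Rightarrow> real^3 \<Rightarrow> real" where
  "const_a12 U b n = - 2 * (b \<bullet> (U *v (cof (U ** U - mat 1) *v n)))"

definition const_a3 ::
  "real^3^3 \<Rightarrow> real^3 \<Rightarrow> real^3 \<Rightarrow> real^3 \<Rightarrow> real^3 \<Rightarrow> real" where
  "const_a3 U b n b' n' =
     (let \<eta> = 2 / (norm b)\<^sup>2 * (b' \<bullet> b);
          A0 = U ** U - mat 1;
          A1 = (U *v b) \<odot> n + n \<odot> (matrix_inv U *v b);
          A2 = (U *v b') \<odot> n' + n' \<odot> (matrix_inv U *v b');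
          A3 = - ((matrix_inv U *v n) \<bullet> b' + \<eta>) *\<^sub>R (n' \<odot> (matrix_inv U *v b))
               - \<eta> *\<^sub>R ((U *v b) \<odot> n')
      in 4 * (cof (A0 + (1/2) *\<^sub>R A2) \<bullet> (A1 + (1/2) *\<^sub>R A3)) + 4 * const_a12 U b n)"

subsection \<open>Branches of zeros\<close>

definition zero_branch :: "(real \<Rightarrow> real \<Rightarrow> real) \<Rightarrow> real set \<Rightarrow> (real \<Rightarrow> real) \<Rightarrow> bool" where
  "zero_branch g S f \<longleftrightarrow> continuous_on S f \<and> (\<forall>\<Lambda>\<in>S. f \<Lambda> \<in> {0..1} \<and> g (f \<Lambda>) \<Lambda> = 0)"

definition branch_from_0 :: "(real \<Rightarrow> real \<Rightarrow> real) \<Rightarrow> real \<Rightarrow> bool" where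
  "branch_from_0 g l \<longleftrightarrow> (\<exists>\<epsilon> f. 0 < \<epsilon> \<and> \<epsilon> \<le> 1 \<and> zero_branch g {0..\<epsilon>} f \<and> f 0 = l)"

definition branch_from_1 :: "(real \<Rightarrow> real \<Rightarrow> real) \<Rightarrow> real \<Rightarrow> bool" where
  "branch_from_1 g l \<longleftrightarrow> (\<exists>\<epsilon> f. 0 < \<epsilon> \<and> \<epsilon> \<le> 1 \<and> zero_branch g {1-\<epsilon>..1} f \<and> f 1 = l)"

(* The branches starting from (l,0) and from (l,1) can be followed to a common point. *)
definition branches_meet :: "(real \<Rightarrow> real \<Rightarrow> real) \<Rightarrow> real \<Rightarrow> bool" where
  "branches_meet g l \<longleftrightarrow>
     (\<exists>c\<in>{0..1}. \<exists>f0 f1. zero_branch g {0..c} f0 \<and> f0 0 = l \<and>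
                          zero_branch g {c..1} f1 \<and> f1 1 = l \<and> f0 c = f1 c)"

end

(* Write U = U_A, b = b_AB, n = n_AB, b' = b_AA', let p be the Type-II axis and m = n_AA' = n_BB'.
   Comparing |U_I y| and |U_J y| for y orthogonal to a compound-twin normal shows that this normal
   is orthogonal to the distinguished axis; hence m is, up to sign, the third coordinate vector, and
   the half-turn about m exchanges A with A' and B with B'.  Since a rotation of the form
   z (x) y - 1 is a half-turn, both twins can be solved, and
   M = U + l b (x) n + L (b' - l eta b) (x) m.  The twinning rotations composed with the half-turns
   about p and m carry M(l,L) to M(1-l,L) and to M(l,1-L), so g is symmetric in both variables.
   As U^-1 M is unipotent, g(l,L) = det(A0 + l A1 + L A2 + l L A3), and as A1 + L A3 and
   A2 + l A3 have rank at most two, g is quadratic in each variable.  A polynomial that is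
   quadratic and symmetric in each variable is bilinear in l^2 - l and L^2 - L.  What remains is the
   study of the function -(a0 + a2 y)/(a1 + a3 y), which is monotone or constant on [-1/4,0]. *)
theory Submission
  imports Defs
begin

subsection \<open>Matrices of order three\<close>

lemma outer_mult_vec: "(b \<odot> n) *v x = (n \<bullet> x) *\<^sub>R b"
  by (simp add: outer_def matrix_vector_mult_def vec_eq_iff inner_vec_def sum_distrib_left sum_distrib_right
      mult_ac)

lemma transpose_outer: "transpose (b \<odot> n) = n \<odot> b"
  by (simp add: outer_def transpose_def vec_eq_iff mult.commute)

lemma inner_outer: "X \<bullet> (b \<odot> n) = b \<bullet> (X *v n)"
  by (simp add: outer_def matrix_vector_mult_def inner_vec_def sum_distrib_left mult_ac)

lemma transpose_diff: "transpose (X - Y) = transpose X - transpose (Y :: real^'n^'m)"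
  by (simp add: transpose_def vec_eq_iff)

lemma transpose_scaleR: "transpose (c *\<^sub>R X) = c *\<^sub>R transpose (X :: real^'n^'m)"
  by (simp add: transpose_def vec_eq_iff)

lemmas mult_vec_simps = outer_mult_vec matrix_vector_mult_add_rdistrib matrix_vector_mult_diff_rdistrib
  scaleR_matrix_vector_assoc [symmetric] matrix_vector_mul_assoc [symmetric]
  matrix_vector_right_distrib matrix_vector_mult_diff_distrib matrix_vector_mult_scaleR
  vec.neg

lemma inner_symmetric_mult_vec:
  fixes X :: "real^'n^'n"
  assumes "transpose X = X"
  shows "x \<bullet> (X *v y) = (X *v x) \<bullet> y"
  using assms dot_lmul_matrix[of x X y] by (metis transpose_matrix_vector)

lemma half_turn_mult_vec: "half_turn p *v x = (2 * (p \<bullet> x)) *\<^sub>R p - x"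
proof -
  have "half_turn p = 2 *\<^sub>R (p \<odot> p) - mat 1" by (simp add: half_turn_def)
  thus ?thesis by (simp add: mult_vec_simps)
qed

lemma transpose_half_turn: "transpose (half_turn p) = half_turn p"
proof -
  have "half_turn p = 2 *\<^sub>R (p \<odot> p) - mat 1" by (simp add: half_turn_def)
  thus ?thesis by (simp add: transpose_diff transpose_scaleR transpose_outer transpose_mat)
qed

lemma half_turn_involution:
  assumes "norm p = 1"
  shows "half_turn p ** half_turn p = mat 1"
proof -
  have "p \<bullet> (half_turn p *v x) = p \<bullet> x" for x
    using assms by (simp add: half_turn_mult_vec inner_simps dot_square_norm)
  hence "half_turn p *v (half_turn p *v x) = x" for x
    by (subst half_turn_mult_vec) (simp add: half_turn_mult_vec)
  thus ?thesis by (simp add: matrix_eq mult_vec_simps)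
qed

lemma det_outer_minus_one: "det (z \<odot> y - mat 1 :: real^3^3) = z \<bullet> y - 1"
  by (simp add: det_3 outer_def mat_def inner_vec_def sum_3 algebra_simps)

lemma det_one_plus_outer: "det (mat 1 + z \<odot> y :: real^3^3) = 1 + z \<bullet> y"
  by (simp add: det_3 outer_def mat_def inner_vec_def sum_3 algebra_simps)

lemma rotation_half_turn:
  assumes "norm p = 1"
  shows "rotation_matrix (half_turn p)"
proof -
  have "half_turn p = (2 *\<^sub>R p) \<odot> p - mat 1"
    by (simp add: matrix_eq mult_vec_simps half_turn_mult_vec)
  hence "det (half_turn p) = 1"
    using assms by (simp add: det_outer_minus_one dot_square_norm)
  thus ?thesis
    using half_turn_involution[OF assms]
    by (simp add: rotation_matrix_def orthogonal_matrix transpose_half_turn)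
qed

lemma rotation_matrix_mul:
  fixes X Y :: "real^'n^'n"
  shows "rotation_matrix X \<Longrightarrow> rotation_matrix Y \<Longrightarrow> rotation_matrix (X ** Y)"
  unfolding rotation_matrix_def by (simp add: det_mul orthogonal_matrix_mul)

lemma rotation_inner:
  fixes X :: "real^'n^'n"
  assumes "rotation_matrix X"
  shows "(X *v x) \<bullet> (X *v y) = x \<bullet> y"
  using assms
  by (metis dot_lmul_matrix matrix_vector_mul_assoc matrix_vector_mul_lid orthogonal_matrix rotation_matrix_def
      transpose_matrix_vector inner_commute)

text \<open>The determinant of a rotation is 1, which gives \<open>y \<bullet> z = 2\<close>.
  Preservation of the inner product of \<open>y\<close> with an arbitrary \<open>x\<close> forces
  \<open>z\<close> to be parallel to \<open>y\<close>, and the first identity fixes the factor. So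
  the rotation is the half-turn about \<open>y\<close>, and knowing \<open>y\<close> determines
  \<open>z\<close>.\<close>

lemma rotation_rank_one:
  assumes rot: "rotation_matrix (z \<odot> y - mat 1)"
  shows "y \<bullet> z = 2" "z = (2 / (y \<bullet> y)) *\<^sub>R y"
proof -
  show yz: "y \<bullet> z = 2"
    using rot by (simp add: rotation_matrix_def det_outer_minus_one inner_commute)
  hence y0: "y \<bullet> y \<noteq> 0" by auto
  have *: "(y \<bullet> y) * (x \<bullet> z) = (z \<bullet> z * (y \<bullet> y) - 2) * (x \<bullet> y)" for x
    using rotation_inner[OF rot, of x y] yz
    by (simp add: mult_vec_simps inner_simps inner_commute algebra_simps)
  have **: "(y \<bullet> y) *\<^sub>R z = (z \<bullet> z * (y \<bullet> y) - 2) *\<^sub>R y"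
    by (rule vector_eq_ldot[THEN iffD1]) (simp add: *)
  have "(y \<bullet> y) * 2 = (z \<bullet> z * (y \<bullet> y) - 2) * (y \<bullet> y)"
    using *[of y] by (simp add: yz)
  hence "z \<bullet> z * (y \<bullet> y) - 2 = 2" using y0 by simp
  with ** have e: "(y \<bullet> y) *\<^sub>R z = 2 *\<^sub>R y" by simp
  have "z = (1 / (y \<bullet> y)) *\<^sub>R ((y \<bullet> y) *\<^sub>R z)" using y0 by simp
  thus "z = (2 / (y \<bullet> y)) *\<^sub>R y" unfolding e by simp
qed

lemma cof_explicit:
  "cof X = vector [
     vector [X$2$2 * X$3$3 - X$2$3 * X$3$2, X$2$3 * X$3$1 - X$2$1 * X$3$3, X$2$1 * X$3$2 - X$2$2 * X$3$1],
     vector [X$1$3 * X$3$2 - X$1$2 * X$3$3, X$1$1 * X$3$3 - X$1$3 * X$3$1, X$1$2 * X$3$1 - X$1$1 * X$3$2],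
     vector [X$1$2 * X$2$3 - X$1$3 * X$2$2, X$1$3 * X$2$1 - X$1$1 * X$2$3, X$1$1 * X$2$2 - X$1$2 * X$2$1]]"
  by (simp add: cof_def vec_eq_iff forall_3 det_3 axis_def)

text \<open>The cofactor matrix is the gradient of the determinant. By homogeneity the quadratic
  term is the linear one with \<open>X\<close> and \<open>Y\<close> exchanged.\<close>

lemma det_add_scaleR:
  "det (X + l *\<^sub>R Y) = det X + l * (cof X \<bullet> Y) + l\<^sup>2 * (cof Y \<bullet> X) + l^3 * det Y"
  by (simp add: cof_explicit det_3 inner_vec_def sum_3 algebra_simps power2_eq_square power3_eq_cube)

lemma transpose_cof_mult: "transpose (cof X) ** X = det X *\<^sub>R mat 1"
  by (simp add: cof_explicit det_3 vec_eq_iff forall_3 matrix_matrix_mult_def sum_3 transpose_def mat_def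
      algebra_simps)

lemma transpose_cof: "transpose (cof X) = cof (transpose X)"
  by (simp add: cof_explicit vec_eq_iff forall_3 transpose_def algebra_simps)

lemma det_two_outers: "det (u \<odot> v + w \<odot> x) = 0"
  by (simp add: det_3 outer_def algebra_simps)

lemma two_sided_inverse:
  fixes U V :: "real^'n^'n"
  assumes "U ** V = mat 1"
  shows "U *v (V *v x) = x" "V *v (U *v x) = x"
  using assms matrix_left_right_inverse[of U V] by (simp_all add: matrix_vector_mul_assoc)

lemma transpose_inverse_symmetric:
  fixes U V :: "real^'n^'n"
  assumes "transpose U = U" "U ** V = mat 1"
  shows "transpose V = V"
proof -
  have "transpose V ** U = mat 1"
    using assms by (metis matrix_transpose_mul transpose_mat)
  thus ?thesis
    using assms(2) by (metis matrix_mul_assoc matrix_mul_lid matrix_mul_rid)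
qed

text \<open>The left rotation cancels in the product with the transpose, and the right one
  conjugates the difference from the identity. Both symmetries of \<open>g\<close> rest on
  this.\<close>

lemma det_strain_rotation:
  fixes X Y Z :: "real^'n^'n"
  assumes "rotation_matrix X" "rotation_matrix Y"
  shows "det (transpose (X ** Z ** Y) ** (X ** Z ** Y) - mat 1) = det (transpose Z ** Z - mat 1)"
proof -
  have X: "transpose X *v (X *v x) = x" and Y: "transpose Y *v (Y *v x) = x" for x
    using assms
    by (simp_all add: rotation_matrix_def orthogonal_matrix matrix_vector_mul_assoc
        del: transpose_matrix_vector)
  have "transpose (X ** Z ** Y) ** (X ** Z ** Y) - mat 1
      = transpose Y ** (transpose Z ** Z - mat 1) ** Y"
    by (simp add: matrix_eq matrix_transpose_mul mult_vec_simps X Y del: transpose_matrix_vector)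
  thus ?thesis
    using assms by (simp add: det_mul det_transpose rotation_matrix_def)
qed

lemma matrix_inv_eq:
  fixes X Y :: "real^'n^'n"
  assumes "X ** Y = mat 1"
  shows "matrix_inv X = Y"
proof -
  have YX: "Y ** X = mat 1" using assms matrix_left_right_inverse by blast
  have "X ** matrix_inv X = mat 1"
    unfolding matrix_inv_def by (rule someI2[of _ Y]) (simp_all add: assms YX)
  thus ?thesis
    by (metis YX matrix_mul_assoc matrix_mul_lid matrix_mul_rid)
qed

text \<open>Comparing the values at 0 and 1 gives \<open>k2 = - k1\<close>, so the linear
  coefficient alone determines the dependence on \<open>l\<close>.\<close>

lemma quadratic_of_symmetric:
  fixes f :: "real \<Rightarrow> real"
  assumes f: "\<And>l. f l = k0 + l * k1 + l\<^sup>2 * k2" and sym: "\<And>l. f (1 - l) = f l"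
  shows "f l = k0 - (l\<^sup>2 - l) * k1"
proof -
  have "k1 + k2 = 0" using sym[of 0] by (simp add: f)
  hence "k2 = - k1" by simp
  thus ?thesis by (simp add: f algebra_simps)
qed

subsection \<open>Type-I and Type-II twins\<close>

text \<open>Solving the twin equation for \<open>R ** half_turn m\<close> leaves a rank-one matrix
  minus the identity, with row factor \<open>V *v m\<close>. As a rotation it is the half-turn about
  \<open>V *v m\<close> by \<open>rotation_rank_one\<close>: the inner product of the two factors
  gives the orthogonality, and their proportionality gives the shear vector.\<close>

lemma type_I_twin:
  assumes U: "transpose U = U" "U ** V = mat 1"
    and m: "norm m = 1" and R: "rotation_matrix R"
    and twin: "R ** (half_turn m ** U ** half_turn m) = U + b \<odot> m"
  shows "R ** half_turn m = (2 *\<^sub>R (U *v m) + b) \<odot> (V *v m) - mat 1"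
    and "b \<bullet> (V *v m) = 0"
    and "b = (2 / ((V *v m) \<bullet> (V *v m))) *\<^sub>R (V *v m) - 2 *\<^sub>R (U *v m)"
proof -
  note V = transpose_inverse_symmetric[OF U] and inv = two_sided_inverse[OF U(2)]
  have hh: "half_turn m *v (half_turn m *v x) = x" for x
    using half_turn_involution[OF m] by (simp add: matrix_vector_mul_assoc)
  have mm: "m \<bullet> m = 1" using m by (simp add: dot_square_norm)
  have tw: "R *v (half_turn m *v (U *v (half_turn m *v x))) = U *v x + (m \<bullet> x) *\<^sub>R b" for x
    using arg_cong[OF twin, of "\<lambda>X. X *v x"] by (simp add: mult_vec_simps)
  have tw': "R *v (half_turn m *v x) = U *v (half_turn m *v (V *v x))
      + (m \<bullet> (half_turn m *v (V *v x))) *\<^sub>R b" for x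
    using tw[of "half_turn m *v (V *v x)"] by (simp only: hh inv)
  show E: "R ** half_turn m = (2 *\<^sub>R (U *v m) + b) \<odot> (V *v m) - mat 1" (is "_ = ?z \<odot> ?y - _")
    unfolding matrix_eq
  proof
    fix x
    show "(R ** half_turn m) *v x = (?z \<odot> ?y - mat 1) *v x"
      unfolding matrix_vector_mul_assoc[symmetric] tw'[of x]
      using mm
      by (simp add: inv mult_vec_simps half_turn_mult_vec inner_simps inner_symmetric_mult_vec[OF V]
          scaleR_left_diff_distrib scaleR_add_right)
  qed
  have "rotation_matrix (R ** half_turn m)"
    by (intro rotation_matrix_mul R rotation_half_turn m)
  note rk = rotation_rank_one[OF this[unfolded E]]
  have "(V *v m) \<bullet> (U *v m) = 1"
    using mm by (simp add: inner_symmetric_mult_vec[OF U(1)] inv)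
  thus "b \<bullet> (V *v m) = 0" using rk(1) by (simp add: inner_simps inner_commute)
  show "b = (2 / ((V *v m) \<bullet> (V *v m))) *\<^sub>R (V *v m) - 2 *\<^sub>R (U *v m)"
    using rk(2) by (simp add: algebra_simps)
qed

text \<open>Here \<open>R ** half_turn p\<close> contains one term along \<open>U *v p\<close> from
  the conjugation and one along \<open>b\<close> from the shear. Since these vectors are parallel,
  the two terms merge into a single rank-one matrix, so the rotation is the half-turn about
  \<open>b\<close>.\<close>

lemma type_II_twin:
  assumes U: "transpose U = U" "U ** V = mat 1"
    and p: "norm p = 1" and R: "rotation_matrix R" and b: "b = c *\<^sub>R (U *v p)" "b \<noteq> 0"
    and twin: "R ** (half_turn p ** U ** half_turn p) = U + b \<odot> n"
  shows "n \<bullet> p = 0"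
    and "R ** half_turn p = ((2 / (b \<bullet> b)) *\<^sub>R b) \<odot> b - mat 1"
    and "n = (2 / c) *\<^sub>R p - (2 / (b \<bullet> b)) *\<^sub>R (U *v b)"
proof -
  note V = transpose_inverse_symmetric[OF U] and inv = two_sided_inverse[OF U(2)]
  have c: "c \<noteq> 0" using b by auto
  have hh: "half_turn p *v (half_turn p *v x) = x" for x
    using half_turn_involution[OF p] by (simp add: matrix_vector_mul_assoc)
  have pp: "p \<bullet> p = 1" using p by (simp add: dot_square_norm)
  have tw: "R *v (half_turn p *v (U *v (half_turn p *v x))) = U *v x + (n \<bullet> x) *\<^sub>R b" for x
    using arg_cong[OF twin, of "\<lambda>X. X *v x"] by (simp add: mult_vec_simps)
  have tw': "R *v (half_turn p *v x) = U *v (half_turn p *v (V *v x))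
      + (n \<bullet> (half_turn p *v (V *v x))) *\<^sub>R b" for x
    using tw[of "half_turn p *v (V *v x)"] by (simp only: hh inv)
  \<comment> \<open>The covector that multiplies \<open>b\<close> after both terms are collected;
    the factor 2 / c arises from writing \<open>U *v p\<close> as \<open>b\<close> divided by
    \<open>c\<close>.\<close>
  define y where "y = (2 / c) *\<^sub>R (V *v p) + V *v (half_turn p *v n)"
  have yx: "y \<bullet> x = (2 / c) * (p \<bullet> (V *v x)) + n \<bullet> (half_turn p *v (V *v x))" for x
    by (simp add: y_def inner_add_left inner_symmetric_mult_vec[OF V, symmetric]
        inner_symmetric_mult_vec[OF transpose_half_turn, symmetric])
  hence cy: "c * (y \<bullet> x) = 2 * (p \<bullet> (V *v x)) + c * (n \<bullet> (half_turn p *v (V *v x)))" for x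
    using c by (simp add: distrib_left)
  have ux: "U *v (half_turn p *v (V *v x)) = (2 * (p \<bullet> (V *v x))) *\<^sub>R (U *v p) - x" for x
    by (simp add: half_turn_mult_vec mult_vec_simps inv)
  have E: "R ** half_turn p = b \<odot> y - mat 1"
    unfolding matrix_eq
  proof
    fix x
    show "(R ** half_turn p) *v x = (b \<odot> y - mat 1) *v x"
      unfolding matrix_vector_mul_assoc[symmetric] tw'[of x]
      using cy[of x] ux[of x]
      by (simp add: mult_vec_simps b(1) mult.commute flip: scaleR_add_left)
  qed
  have "rotation_matrix (R ** half_turn p)"
    by (intro rotation_matrix_mul R rotation_half_turn p)
  note rk = rotation_rank_one[OF this[unfolded E]]
  have "y \<bullet> b = 2 + c * (n \<bullet> p)"
    using c pp
    by (simp add: yx b(1) mult_vec_simps inv half_turn_mult_vec inner_simps inner_commute distrib_left)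
  thus np: "n \<bullet> p = 0" using rk(1) c by simp
  have yb: "y = (2 / (b \<bullet> b)) *\<^sub>R b"
  proof -
    have "y \<bullet> y \<noteq> 0" using rk(1) by auto
    define k where "k = 2 / (y \<bullet> y)"
    have k: "k \<noteq> 0" "b = k *\<^sub>R y" "k * (y \<bullet> y) = 2"
      using rk(2) \<open>y \<bullet> y \<noteq> 0\<close> by (simp_all add: k_def)
    have "b \<bullet> b = k * (k * (y \<bullet> y))" by (simp add: k(2))
    hence "2 / (b \<bullet> b) = 1 / k" unfolding k(3) by simp
    thus ?thesis using k(1,2) by simp
  qed
  show "R ** half_turn p = ((2 / (b \<bullet> b)) *\<^sub>R b) \<odot> b - mat 1"
    unfolding E yb by (simp add: matrix_eq mult_vec_simps inner_simps)
  \<comment> \<open>Apply \<open>U\<close> to the definition of \<open>y\<close>; the half-turn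
    sends \<open>n\<close> to its negative because \<open>n\<close> is orthogonal to
    \<open>p\<close>.\<close>
  have "n = (2 / c) *\<^sub>R p - U *v y"
    using np by (simp add: y_def mult_vec_simps inv half_turn_mult_vec inner_commute)
  thus "n = (2 / c) *\<^sub>R p - (2 / (b \<bullet> b)) *\<^sub>R (U *v b)"
    unfolding yb by (simp add: matrix_vector_mult_scaleR)
qed

subsection \<open>Crossing twins\<close>

text \<open>The partners of \<open>U\<close> enter only as its conjugates by the half-turns about
  \<open>p\<close> and \<open>m\<close>, and \<open>V\<close> is the inverse of \<open>U\<close>.
  The coordinates of the variants are thereby left out of the analysis of \<open>g\<close>.\<close>

locale crossing_twins =
  fixes U V R S :: "real^3^3" and b n b' m p :: "real^3" and c :: real
  assumes U: "transpose U = U" "U ** V = mat 1"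
    and unit: "norm p = 1" "norm m = 1" and pm: "p \<bullet> m = 0"
    and b: "b = c *\<^sub>R (U *v p)" "b \<noteq> 0"
    and R: "rotation_matrix R" "R ** (half_turn p ** U ** half_turn p) = U + b \<odot> n"
    and S: "rotation_matrix S" "S ** (half_turn m ** U ** half_turn m) = U + b' \<odot> m"
begin

definition "\<eta> = 2 / (b \<bullet> b) * (b' \<bullet> b)"

text \<open>The shear along \<open>m\<close> interpolates between \<open>b'\<close> at l = 0 and its
  counterpart \<open>b' - \<eta> *\<^sub>R b\<close> at l = 1, which
  \<open>conjugate_compound_shear\<close> supplies.\<close>

definition "M l \<Lambda> = U + (l *\<^sub>R b) \<odot> n + (\<Lambda> *\<^sub>R (b' - (l * \<eta>) *\<^sub>R b)) \<odot> m"

definition "g l \<Lambda> = det (transpose (M l \<Lambda>) ** M l \<Lambda> - mat 1)"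

lemmas V = transpose_inverse_symmetric[OF U] and inv = two_sided_inverse[OF U(2)]
lemmas typeI = type_I_twin[OF U unit(2) S] and typeII = type_II_twin[OF U unit(1) R(1) b R(2)]

lemma mm: "m \<bullet> m = 1"
  using unit by (simp add: dot_square_norm)

lemma bb: "b \<bullet> b \<noteq> 0" using b(2) by simp

lemma Vb: "V *v b = c *\<^sub>R p"
  by (simp add: b(1) matrix_vector_mult_scaleR inv)

lemma m_Vb: "m \<bullet> (V *v b) = 0" "(V *v m) \<bullet> b = 0"
proof -
  show "m \<bullet> (V *v b) = 0" using pm by (simp add: Vb inner_commute)
  thus "(V *v m) \<bullet> b = 0" by (simp add: inner_symmetric_mult_vec[OF V])
qed

lemma n_Vb: "n \<bullet> (V *v b) = 0"
  using typeII(1) by (simp add: Vb)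

lemma m_Vb': "m \<bullet> (V *v b') = 0"
  using typeI(2) by (metis inner_symmetric_mult_vec[OF V] inner_commute)

text \<open>The explicit formulas for \<open>b'\<close> and \<open>n\<close> reduce both sides to
  the same multiple of \<open>(U *v m) \<bullet> b\<close>. This is what makes \<open>n\<close>
  transform correctly under the half-turn about \<open>m\<close>.\<close>

lemma eta_eq: "\<eta> = 2 * (n \<bullet> m)"
proof -
  have "b' \<bullet> b = - 2 * ((U *v m) \<bullet> b)"
    by (subst typeI(3)) (simp add: inner_diff_left m_Vb)
  moreover have "n \<bullet> m = - (2 / (b \<bullet> b)) * ((U *v m) \<bullet> b)"
    by (subst typeII(3)) (simp add: inner_diff_left pm
        inner_symmetric_mult_vec[OF U(1), of m b, symmetric] inner_commute[of "U *v b" m])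
  ultimately show ?thesis by (simp add: \<eta>_def)
qed

section \<open>Reflection symmetries of \<open>g\<close>\<close>

lemma M_mult_vec:
  "M l \<Lambda> *v x = U *v x + (l * (n \<bullet> x)) *\<^sub>R b + (\<Lambda> * (m \<bullet> x)) *\<^sub>R b'
     - (\<Lambda> * l * \<eta> * (m \<bullet> x)) *\<^sub>R b"
  by (simp add: M_def mult_vec_simps scaleR_diff_right mult_ac)

text \<open>The half-turn about \<open>p\<close> reverses \<open>n\<close> and \<open>m\<close>. The
  rotation \<open>Q\<close> is the half-turn about \<open>b\<close>: it fixes \<open>b\<close> and
  sends \<open>b'\<close> to \<open>\<eta> *\<^sub>R b - b'\<close>. Together they carry
  \<open>U\<close> to \<open>U + b \<odot> n\<close> and exchange l with 1 - l in the
  shears.\<close>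

lemma g_reflect_l: "g (1 - l) \<Lambda> = g l \<Lambda>"
proof -
  define Q where "Q = R ** half_turn p"
  have Qx: "Q *v x = (2 / (b \<bullet> b) * (b \<bullet> x)) *\<^sub>R b - x" for x
    by (simp add: Q_def typeII(2) mult_vec_simps)
  have Qb: "Q *v b = b" using bb by (simp add: Qx scaleR_2)
  have Qb': "Q *v b' = \<eta> *\<^sub>R b - b'" by (simp add: Qx \<eta>_def inner_commute)
  have QU: "Q *v (U *v (half_turn p *v x)) = U *v x + (n \<bullet> x) *\<^sub>R b" for x
    using arg_cong[OF R(2), of "\<lambda>X. X *v x"] by (simp add: Q_def mult_vec_simps)
  have n: "n \<bullet> (half_turn p *v x) = - (n \<bullet> x)" and m: "m \<bullet> (half_turn p *v x) = - (m \<bullet> x)" for x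
    using typeII(1) pm by (simp_all add: half_turn_mult_vec inner_diff_right inner_commute)
  have "Q ** M l \<Lambda> ** half_turn p = M (1 - l) \<Lambda>"
    by (simp add: matrix_eq matrix_vector_mul_assoc[symmetric] M_mult_vec n m QU Qb Qb'
        matrix_vector_right_distrib matrix_vector_mult_diff_distrib matrix_vector_mult_scaleR
        algebra_simps)
  thus ?thesis
    using det_strain_rotation[of Q "half_turn p" "M l \<Lambda>"]
    by (simp add: g_def Q_def R(1) rotation_half_turn rotation_matrix_mul unit)
qed

text \<open>Now \<open>Q\<close> reverses both \<open>b\<close> and \<open>b'\<close>, while the
  half-turn about \<open>m\<close> fixes \<open>m\<close> and sends \<open>n\<close> to
  \<open>\<eta> *\<^sub>R m - n\<close>. The extra multiple of \<open>m\<close> is absorbed by the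
  mixed term of \<open>M\<close>.\<close>

lemma g_reflect_\<Lambda>: "g l (1 - \<Lambda>) = g l \<Lambda>"
proof -
  define Q where "Q = S ** half_turn m"
  have Qx: "Q *v x = ((V *v m) \<bullet> x) *\<^sub>R (2 *\<^sub>R (U *v m) + b') - x" for x
    by (simp add: Q_def typeI(1) mult_vec_simps)
  have Qb: "Q *v b = - b" by (simp add: Qx m_Vb)
  have Qb': "Q *v b' = - b'" using typeI(2) by (simp add: Qx inner_commute)
  have QU: "Q *v (U *v (half_turn m *v x)) = U *v x + (m \<bullet> x) *\<^sub>R b'" for x
    using arg_cong[OF S(2), of "\<lambda>X. X *v x"] by (simp add: Q_def mult_vec_simps)
  have n: "n \<bullet> (half_turn m *v x) = \<eta> * (m \<bullet> x) - n \<bullet> x"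
    and m: "m \<bullet> (half_turn m *v x) = m \<bullet> x" for x
    using mm by (simp_all add: half_turn_mult_vec inner_diff_right eta_eq inner_commute)
  have "Q ** M l \<Lambda> ** half_turn m = M l (1 - \<Lambda>)"
    by (simp add: matrix_eq matrix_vector_mul_assoc[symmetric] M_mult_vec n m QU Qb Qb'
        matrix_vector_right_distrib matrix_vector_mult_diff_distrib matrix_vector_mult_scaleR
        algebra_simps)
  thus ?thesis
    using det_strain_rotation[of Q "half_turn m" "M l \<Lambda>"]
    by (simp add: g_def Q_def S(1) rotation_half_turn rotation_matrix_mul unit)
qed

section \<open>The determinant as a polynomial in l and \<Lambda>\<close>

definition "A0 = U ** U - mat 1"
definition "A1 = (U *v b) \<odot> n + n \<odot> (V *v b)"
definition "A2 = (U *v b') \<odot> m + m \<odot> (V *v b')"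
definition "A3 = - ((V *v n) \<bullet> b' + \<eta>) *\<^sub>R (m \<odot> (V *v b)) - \<eta> *\<^sub>R ((U *v b) \<odot> m)"

text \<open>The factor \<open>K = U\<^sup>-\<^sup>1 M\<close> is unipotent, so \<open>N = K\<^sup>-\<^sup>1\<close> is polynomial in \<open>l\<close> and \<open>\<Lambda>\<close>,
  and \<open>M\<^sup>T M - 1 = K\<^sup>T (U M - N\<^sup>T)\<close>.\<close>

lemma g_bilinear: "g l \<Lambda> = det (A0 + l *\<^sub>R A1 + \<Lambda> *\<^sub>R A2 + (l * \<Lambda>) *\<^sub>R A3)"
proof -
  \<comment> \<open>The terms of \<open>V ** M l \<Lambda>\<close> are grouped by their column
    vectors \<open>V *v b\<close> and \<open>V *v b'\<close>, with covectors \<open>v\<close> and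
    \<open>m\<close>. Orthogonality makes \<open>X ** X\<close>, \<open>Y ** Y\<close> and
    \<open>Y ** X\<close> vanish, hence \<open>K = mat 1 + X + Y\<close> with inverse
    \<open>N\<close>.\<close>
  define v where "v = n - (\<Lambda> * \<eta>) *\<^sub>R m"
  define X where "X = (l *\<^sub>R (V *v b)) \<odot> v"
  define Y where "Y = (\<Lambda> *\<^sub>R (V *v b')) \<odot> m"
  define K where "K = (mat 1 + Y) ** (mat 1 + X)"
  define N where "N = (mat 1 - X) ** (mat 1 - Y)"
  have vVb: "v \<bullet> (V *v b) = 0" by (simp add: v_def inner_diff_left n_Vb m_Vb)
  have detK: "det K = 1"
    by (simp add: K_def X_def Y_def det_mul det_one_plus_outer m_Vb' vVb inner_commute)
  have KN: "N ** K = mat 1"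
    by (simp add: matrix_eq N_def K_def X_def Y_def mult_vec_simps inner_simps vVb m_Vb m_Vb')
  have Keq: "K = mat 1 + X + Y"
    by (simp add: matrix_eq K_def X_def Y_def mult_vec_simps inner_simps m_Vb)
  have UK: "M l \<Lambda> = U ** K"
    by (simp add: matrix_eq Keq X_def Y_def v_def M_mult_vec mult_vec_simps inv inner_diff_left algebra_simps)
  have tKN: "transpose K *v (transpose N *v x) = x" for x
    using KN by (metis matrix_transpose_mul transpose_mat matrix_vector_mul_assoc matrix_vector_mul_lid)
  have "transpose (M l \<Lambda>) ** M l \<Lambda> - mat 1 = transpose K ** (U ** U ** K - transpose N)"
    by (simp add: UK matrix_eq matrix_transpose_mul mult_vec_simps tKN U(1)
        del: transpose_matrix_vector)
  hence 1: "g l \<Lambda> = det (U ** U ** K - transpose N)"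
    by (simp add: g_def det_mul det_transpose detK)
  have tN: "transpose N = (mat 1 - m \<odot> (\<Lambda> *\<^sub>R (V *v b'))) ** (mat 1 - v \<odot> (l *\<^sub>R (V *v b)))"
    by (simp add: N_def matrix_transpose_mul X_def Y_def transpose_diff transpose_outer transpose_mat)
  \<comment> \<open>The product \<open>X ** Y\<close> survives in \<open>N\<close>; its coefficient
    is the inner product of \<open>V *v n\<close> and \<open>b'\<close> that occurs in
    \<open>A3\<close>.\<close>
  have vVb': "(V *v b') \<bullet> v = (V *v n) \<bullet> b'"
    using m_Vb' inner_symmetric_mult_vec[OF V, of b' n]
    by (simp add: v_def inner_diff_right inner_commute)
  have "U ** U ** K - transpose N = A0 + l *\<^sub>R A1 + \<Lambda> *\<^sub>R A2 + (l * \<Lambda>) *\<^sub>R A3"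
    unfolding matrix_eq tN
    by (simp add: Keq X_def Y_def A0_def A1_def A2_def A3_def mult_vec_simps inv vVb' inner_simps)
       (simp add: v_def inner_simps algebra_simps)
  with 1 show ?thesis by simp
qed

text \<open>For fixed \<Lambda> the coefficient matrix of l is a sum of two outer products, so the
  determinant has no cubic term in l. The next lemma does the same for \<Lambda>.\<close>

lemma det_A1: "det (A1 + \<Lambda> *\<^sub>R A3) = 0"
proof -
  have "A1 + \<Lambda> *\<^sub>R A3 = (U *v b) \<odot> (n - (\<Lambda> * \<eta>) *\<^sub>R m)
      + (n - (\<Lambda> * ((V *v n) \<bullet> b' + \<eta>)) *\<^sub>R m) \<odot> (V *v b)"
    by (simp add: matrix_eq A1_def A3_def mult_vec_simps inner_simps algebra_simps)
  thus ?thesis by (simp only: det_two_outers)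
qed

lemma det_A2: "det (A2 + l *\<^sub>R A3) = 0"
proof -
  have "A2 + l *\<^sub>R A3 = (U *v b' - (l * \<eta>) *\<^sub>R (U *v b)) \<odot> m
      + m \<odot> (V *v b' - (l * ((V *v n) \<bullet> b' + \<eta>)) *\<^sub>R (V *v b))"
    by (simp add: matrix_eq A2_def A3_def mult_vec_simps inner_simps algebra_simps)
  thus ?thesis by (simp only: det_two_outers)
qed

lemma g_quadratic_l:
  "g l \<Lambda> = g 0 \<Lambda> - (l\<^sup>2 - l) * (cof (A0 + \<Lambda> *\<^sub>R A2) \<bullet> (A1 + \<Lambda> *\<^sub>R A3))"
proof (rule quadratic_of_symmetric)
  fix l
  have "g l \<Lambda> = det ((A0 + \<Lambda> *\<^sub>R A2) + l *\<^sub>R (A1 + \<Lambda> *\<^sub>R A3))"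
    by (simp add: g_bilinear algebra_simps)
  also have "\<dots> = g 0 \<Lambda> + l * (cof (A0 + \<Lambda> *\<^sub>R A2) \<bullet> (A1 + \<Lambda> *\<^sub>R A3))
     + l\<^sup>2 * (cof (A1 + \<Lambda> *\<^sub>R A3) \<bullet> (A0 + \<Lambda> *\<^sub>R A2))"
    unfolding det_add_scaleR[of "A0 + \<Lambda> *\<^sub>R A2"] det_A1 by (simp add: g_bilinear)
  finally show "g l \<Lambda> = \<dots>" .
qed (rule g_reflect_l)

lemma g_quadratic_\<Lambda>:
  "g l \<Lambda> = g l 0 - (\<Lambda>\<^sup>2 - \<Lambda>) * (cof (A0 + l *\<^sub>R A1) \<bullet> (A2 + l *\<^sub>R A3))"
proof (rule quadratic_of_symmetric)
  fix \<Lambda>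
  have "g l \<Lambda> = det ((A0 + l *\<^sub>R A1) + \<Lambda> *\<^sub>R (A2 + l *\<^sub>R A3))"
    by (simp add: g_bilinear algebra_simps)
  also have "\<dots> = g l 0 + \<Lambda> * (cof (A0 + l *\<^sub>R A1) \<bullet> (A2 + l *\<^sub>R A3))
     + \<Lambda>\<^sup>2 * (cof (A2 + l *\<^sub>R A3) \<bullet> (A0 + l *\<^sub>R A1))"
    unfolding det_add_scaleR[of "A0 + l *\<^sub>R A1"] det_A2 by (simp add: g_bilinear)
  finally show "g l \<Lambda> = \<dots>" .
qed (rule g_reflect_\<Lambda>)

text \<open>Both outer products contribute equally, which explains the factor 2 in
  \<open>const_a12\<close>. Indeed \<open>cof A0\<close> applied to
  \<open>A0 *v (V *v y) = U *v y - V *v y\<close> gives a multiple of \<open>V *v y\<close>, and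
  this is orthogonal to \<open>x\<close>.\<close>

lemma cof_A0_inner:
  assumes "x \<bullet> (V *v y) = 0"
  shows "cof A0 \<bullet> ((U *v y) \<odot> x + x \<odot> (V *v y)) = - const_a12 U y x"
proof -
  have tA0: "transpose A0 = A0"
    by (simp add: A0_def transpose_diff matrix_transpose_mul U(1) transpose_mat)
  hence tC: "transpose (cof A0) = cof A0" by (simp add: transpose_cof)
  have "cof A0 *v (A0 *v (V *v y)) = det A0 *\<^sub>R (V *v y)"
    using arg_cong[OF transpose_cof_mult[of A0], of "\<lambda>X. X *v (V *v y)"]
    by (simp add: tC mult_vec_simps)
  moreover have "A0 *v (V *v y) = U *v y - V *v y"
    by (simp add: A0_def mult_vec_simps inv)
  ultimately have "cof A0 *v (V *v y) = cof A0 *v (U *v y) - det A0 *\<^sub>R (V *v y)"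
    by (simp add: matrix_vector_mult_diff_distrib algebra_simps)
  hence "x \<bullet> (cof A0 *v (V *v y)) = x \<bullet> (cof A0 *v (U *v y))"
    using assms by (simp add: inner_diff_right)
  moreover have "x \<bullet> (cof A0 *v (U *v y)) = (U *v y) \<bullet> (cof A0 *v x)"
    by (metis inner_symmetric_mult_vec[OF tC] inner_commute)
  ultimately show ?thesis
    unfolding inner_add_right inner_outer const_a12_def A0_def[symmetric]
      inner_symmetric_mult_vec[OF U(1), of y "cof A0 *v x"] by simp
qed

text \<open>At l = 1/2 the expansion in \<Lambda> shows that the coefficient \<open>H\<close> of the
  expansion in l is affine in \<Lambda>^2 - \<Lambda>. Its values at \<Lambda> = 0 and \<Lambda> =
  1/2 determine it; the factor 4 in \<open>const_a3\<close> comes from the value -1/4 of the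
  parabola at 1/2.\<close>

lemma g_form:
  "g l \<Lambda> = const_a0 U + const_a12 U b n * (l\<^sup>2 - l) + const_a12 U b' m * (\<Lambda>\<^sup>2 - \<Lambda>)
     + const_a3 U b n b' m * (l\<^sup>2 - l) * (\<Lambda>\<^sup>2 - \<Lambda>)"
proof -
  define H where "H \<Lambda> = cof (A0 + \<Lambda> *\<^sub>R A2) \<bullet> (A1 + \<Lambda> *\<^sub>R A3)" for \<Lambda>
  have Vinv: "matrix_inv U = V"
    by (rule matrix_inv_eq[OF U(2)])
  have a0: "g 0 0 = const_a0 U" by (simp add: g_bilinear A0_def const_a0_def)
  have a1: "H 0 = - const_a12 U b n"
    using cof_A0_inner[OF n_Vb] by (simp add: H_def A1_def)
  have a2: "g 0 \<Lambda> = g 0 0 + (\<Lambda>\<^sup>2 - \<Lambda>) * const_a12 U b' m" for \<Lambda>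
    using g_quadratic_\<Lambda>[of 0 \<Lambda>] cof_A0_inner[OF m_Vb'] by (simp add: A2_def)
  have "\<eta> = 2 / (norm b)\<^sup>2 * (b' \<bullet> b)" by (simp add: \<eta>_def dot_square_norm)
  note eta = this[symmetric]
  have a3: "const_a3 U b n b' m = 4 * H (1/2) + 4 * const_a12 U b n"
    unfolding const_a3_def Let_def Vinv eta H_def A0_def A1_def A2_def A3_def by (rule refl)
  have g: "g l \<Lambda> = g 0 \<Lambda> - (l\<^sup>2 - l) * H \<Lambda>" for l \<Lambda>
    unfolding H_def by (rule g_quadratic_l)
  define k where "k = cof (A0 + (1/2) *\<^sub>R A1) \<bullet> (A2 + (1/2) *\<^sub>R A3)"
  have half: "g (1/2) \<Lambda> = g (1/2) 0 - (\<Lambda>\<^sup>2 - \<Lambda>) * k" for \<Lambda>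
    unfolding k_def by (rule g_quadratic_\<Lambda>)
  have H: "H \<Lambda> = H 0 - 4 * (\<Lambda>\<^sup>2 - \<Lambda>) * (k + const_a12 U b' m)" for \<Lambda>
    using half[of \<Lambda>] g[of "1/2" \<Lambda>] g[of "1/2" 0] a2[of \<Lambda>]
    by (simp add: power2_eq_square field_simps)
  have k: "k + const_a12 U b' m = H (1/2) - H 0"
    using H[of "1/2"] by (simp add: power2_eq_square)
  show ?thesis
    unfolding g[of l \<Lambda>] H[of \<Lambda>] k a2[of \<Lambda>] a0 a3 a1 by (simp add: algebra_simps)
qed

text \<open>The half-turn about \<open>p\<close> reverses \<open>m\<close>, so the explicit Type-I
  formula gives for the conjugate variant the shear \<open>d = - (half_turn p *v b')\<close>. It
  remains to apply \<open>R ** half_turn p\<close>, the half-turn about \<open>b\<close>.\<close>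

lemma conjugate_compound_shear:
  assumes UB: "UB = half_turn p ** U ** half_turn p"
    and T: "rotation_matrix T" "T ** (half_turn m ** UB ** half_turn m) = UB + d \<odot> m"
  shows "R *v d = b' - \<eta> *\<^sub>R b"
proof -
  define VB where "VB = half_turn p ** V ** half_turn p"
  have hh: "half_turn p *v (half_turn p *v x) = x" for x
    using half_turn_involution[OF unit(1)] by (simp add: matrix_vector_mul_assoc)
  have Pm: "half_turn p *v m = - m" by (simp add: half_turn_mult_vec pm)
  have tUB: "transpose UB = UB"
    by (simp add: UB matrix_transpose_mul transpose_half_turn U(1) matrix_mul_assoc)
  have UVB: "UB ** VB = mat 1"
    by (simp add: matrix_eq UB VB_def mult_vec_simps hh inv)
  have UBm: "UB *v m = - (half_turn p *v (U *v m))" and VBm: "VB *v m = - (half_turn p *v (V *v m))"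
    by (simp_all add: UB VB_def matrix_vector_mul_assoc[symmetric] Pm vec.neg)
  have "(VB *v m) \<bullet> (VB *v m) = (V *v m) \<bullet> (V *v m)"
    by (simp add: VBm rotation_inner[OF rotation_half_turn[OF unit(1)]])
  hence "d = (2 / ((V *v m) \<bullet> (V *v m))) *\<^sub>R (VB *v m) - 2 *\<^sub>R (UB *v m)"
    using type_I_twin(3)[OF tUB UVB unit(2) T] by simp
  also have "\<dots> = - (half_turn p *v ((2 / ((V *v m) \<bullet> (V *v m))) *\<^sub>R (V *v m) - 2 *\<^sub>R (U *v m)))"
    by (simp add: UBm VBm matrix_vector_mult_diff_distrib matrix_vector_mult_scaleR)
  also have "\<dots> = - (half_turn p *v b')" by (simp only: typeI(3)[symmetric])
  finally have "R *v d = - ((R ** half_turn p) *v b')"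
    by (simp add: matrix_vector_mul_assoc[symmetric] vec.neg)
  thus ?thesis
    by (simp add: typeII(2) mult_vec_simps \<eta>_def inner_commute)
qed

end

subsection \<open>Variants\<close>

lemma transpose_variant_matrix: "transpose (variant_matrix \<alpha> \<beta> \<gamma> I) = variant_matrix \<alpha> \<beta> \<gamma> I"
  by (cases I) (simp_all add: transpose_def vec_eq_iff forall_3 Let_def)

lemma det_variant_matrix: "det (variant_matrix \<alpha> \<beta> \<gamma> I) = \<alpha> * \<beta> * \<gamma>"
  by (cases I) (simp_all add: det_3 Let_def field_simps)

lemma twin_normal_distinguished_axis:
  assumes pos: "\<alpha> > 0" "\<gamma> > 0" "\<alpha> \<noteq> \<gamma>"
    and IJ: "compound_counterpart I J"
    and twin: "is_twin (variant_matrix \<alpha> \<beta> \<gamma> I) (variant_matrix \<alpha> \<beta> \<gamma> J) R b n"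
  shows "n $ distinguished_axis I = 0"
proof (rule ccontr)
  assume nz: "n $ distinguished_axis I \<noteq> 0"
  define k where "k = distinguished_axis I"
  \<comment> \<open>Orthogonal to \<open>n\<close>, with both coordinates off the distinguished axis
    equal to 1. On these coordinates one of the two variants gives \<alpha> twice and the other
    \<gamma> twice, while the coordinate on the axis agrees, so equal lengths force \<alpha>^2 =
    \<gamma>^2.\<close>
  define y :: "real^3" where
    "y = (\<chi> i. if i = k then (n $ k - (n $ 1 + n $ 2 + n $ 3)) / n $ k else 1)"
  have "n $ k * y $ k = n $ k - (n $ 1 + n $ 2 + n $ 3)" using nz by (simp add: y_def k_def)
  hence ny: "n \<bullet> y = 0"
    using exhaust_3[of k] by (auto simp: y_def inner_vec_def sum_3)
  let ?UI = "variant_matrix \<alpha> \<beta> \<gamma> I" and ?UJ = "variant_matrix \<alpha> \<beta> \<gamma> J"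
  have rot: "rotation_matrix R" and "R ** ?UJ = ?UI + b \<odot> n"
    using twin by (auto simp: is_twin_def algebra_simps)
  from this(2) have "R *v (?UJ *v y) = ?UI *v y"
    using ny by (simp add: matrix_vector_mul_assoc mult_vec_simps(2) outer_mult_vec)
  hence "(?UJ *v y) \<bullet> (?UJ *v y) = (?UI *v y) \<bullet> (?UI *v y)"
    using rotation_inner[OF rot, of "?UJ *v y" "?UJ *v y"] by simp
  hence "\<alpha>\<^sup>2 = \<gamma>\<^sup>2"
    using IJ by (cases I; cases J)
      (simp_all add: compound_counterpart_def k_def y_def inner_vec_def sum_3 matrix_vector_mult_def
        Let_def power2_eq_square field_simps)
  thus False using pos by (simp add: power2_eq_iff_nonneg)
qed

text \<open>If \<open>m\<close> is orthogonal to the axes \<open>k\<close> and \<open>l\<close>, it spans the third coordinate axis.\<close>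

lemma compound_counterpart_half_turn:
  assumes IJ: "compound_counterpart I J" and m: "norm m = 1"
    and axes: "distinguished_axis I \<noteq> l" "m $ distinguished_axis I = 0" "m $ l = 0"
  shows "variant_matrix \<alpha> \<beta> \<gamma> J = half_turn m ** variant_matrix \<alpha> \<beta> \<gamma> I ** half_turn m"
proof -
  have "m \<bullet> m = 1" using m by (simp add: dot_square_norm)
  hence "m $ 1 * m $ 1 + m $ 2 * m $ 2 + m $ 3 * m $ 3 = 1"
    by (simp add: inner_vec_def sum_3)
  \<comment> \<open>The half-turn is diagonal with entry 1 on the third axis and -1 on the other
    two; conjugation by it only changes the sign of the off-diagonal entries.\<close>
  thus ?thesis
    using IJ axes exhaust_3[of l]
    by (cases I; cases J)
      (auto simp: compound_counterpart_def half_turn_def outer_def mat_def vec_eq_iff forall_3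
        matrix_matrix_mult_def sum_3 Let_def, (simp add: field_simps)+)
qed

lemma twin_rotation_axis_properties:
  assumes p: "twin_rotation_axis \<alpha> \<beta> \<gamma> I J p"
    and m: "m $ distinguished_axis I = 0" "m $ distinguished_axis J = 0"
  shows "norm p = 1" "p \<bullet> m = 0"
    "variant_matrix \<alpha> \<beta> \<gamma> J = half_turn p ** variant_matrix \<alpha> \<beta> \<gamma> I ** half_turn p"
proof -
  define k l where "k = distinguished_axis I" and "l = distinguished_axis J"
  have kl: "k \<noteq> l" "m $ k = 0" "m $ l = 0"
    using p m by (auto simp: twin_rotation_axis_def Let_def k_def l_def)
  have cases: "p = (1 / sqrt 2) *\<^sub>R (axis k 1 + axis l 1) \<or> p = (1 / sqrt 2) *\<^sub>R (axis k 1 - axis l 1) \<or>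
      p = - (1 / sqrt 2) *\<^sub>R (axis k 1 + axis l 1) \<or> p = - (1 / sqrt 2) *\<^sub>R (axis k 1 - axis l 1)"
    using p by (simp add: twin_rotation_axis_def Let_def k_def l_def)
  hence "p \<bullet> p = 1"
    using kl(1) by (auto simp: inner_simps inner_axis_axis)
  thus "norm p = 1" by (simp add: norm_eq_1)
  show "p \<bullet> m = 0"
    using cases kl by (auto simp: inner_simps inner_axis' inner_axis)
  show "variant_matrix \<alpha> \<beta> \<gamma> J = half_turn p ** variant_matrix \<alpha> \<beta> \<gamma> I ** half_turn p"
    using p by (simp add: twin_rotation_axis_def Let_def)
qed

subsection \<open>Zeros of a bilinear form in two parabolas\<close>

lemma parabola_unit_interval:
  fixes l :: real
  assumes "l \<in> {0..1}"
  shows "l\<^sup>2 - l \<in> {-1/4..0}"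
proof -
  have "0 \<le> (l - 1/2)\<^sup>2" "l * (1 - l) \<ge> 0" using assms by auto
  thus ?thesis by (simp add: power2_eq_square algebra_simps)
qed

lemma parabola_eq_iff:
  fixes l k :: real
  shows "l\<^sup>2 - l = k\<^sup>2 - k \<longleftrightarrow> l = k \<or> l = 1 - k"
proof -
  have "l\<^sup>2 - l = k\<^sup>2 - k \<longleftrightarrow> (l - k) * (l - (1 - k)) = 0"
    by (simp add: power2_eq_square algebra_simps)
  thus ?thesis by (simp only: mult_eq_0_iff right_minus_eq)
qed

locale bilinear_zero_set =
  fixes g :: "real \<Rightarrow> real \<Rightarrow> real" and a0 a1 a2 a3 lstar :: real
  assumes g_eq: "g l \<Lambda> = a0 + a1 * (l\<^sup>2 - l) + a2 * (\<Lambda>\<^sup>2 - \<Lambda>)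
      + a3 * (l\<^sup>2 - l) * (\<Lambda>\<^sup>2 - \<Lambda>)"
    and a3_nz: "a3 \<noteq> 0" and ratio: "a1 / a3 \<notin> {0..1/4}"
    and lstar: "lstar \<in> {0<..1/2}" "lstar\<^sup>2 - lstar = - (a0 / a1)"
begin

text \<open>The argument stands for \<Lambda>^2 - \<Lambda>, which runs through [-1/4, 0]: 0 belongs
  to \<Lambda> = 0 and \<Lambda> = 1, and -1/4 to \<Lambda> = 1/2.\<close>

definition "\<phi> y = - ((a0 + a2 * y) / (a1 + a3 * y))"

lemma a1_nz: "a1 \<noteq> 0"
  using ratio by auto

lemma denominator_nz:
  assumes "y \<in> {-1/4..0}"
  shows "a1 + a3 * y \<noteq> 0"
proof
  assume "a1 + a3 * y = 0"
  hence "a1 / a3 = - y" using a3_nz by (simp add: field_simps)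
  thus False using ratio assms by auto
qed

text \<open>Dividing by \<open>a3\<close> turns the denominator into \<open>a1 / a3 + y\<close>,
  which cannot change sign on [-1/4, 0] because \<open>a1 / a3\<close> lies outside
  [0, 1/4].\<close>

lemma denominator_pos:
  assumes "y \<in> {-1/4..0}"
  shows "(a1 + a3 * y) / a3 * (a1 / a3) > 0"
proof (cases "a1 / a3 < 0")
  case True
  hence "(a1 + a3 * y) / a3 < 0" using assms a3_nz by (simp add: add_divide_distrib)
  thus ?thesis using True by (rule mult_neg_neg)
next
  case False
  hence "a1 / a3 > 1/4" using ratio by auto
  moreover from this have "a1 / a3 + y > 0" using assms unfolding atLeastAtMost_iff by linarith
  hence "(a1 + a3 * y) / a3 > 0" using a3_nz by (simp add: add_divide_distrib)
  ultimately show ?thesis by (intro mult_pos_pos; linarith)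
qed

lemma denominators_same_sign:
  assumes "y \<in> {-1/4..0}" "z \<in> {-1/4..0}"
  shows "(a1 + a3 * y) * (a1 + a3 * z) > 0"
proof -
  have "0 < ((a1 + a3 * y) / a3 * (a1 / a3)) * ((a1 + a3 * z) / a3 * (a1 / a3))"
    by (intro mult_pos_pos denominator_pos assms)
  also have "\<dots> = ((a1 + a3 * y) * (a1 + a3 * z)) * (a1 / a3 / a3)\<^sup>2"
    by (simp add: power2_eq_square)
  finally show ?thesis
    by (metis zero_less_mult_pos2 zero_le_power2 zero_less_mult_iff not_less)
qed

lemma zero_iff:
  assumes "\<Lambda> \<in> {0..1}"
  shows "g l \<Lambda> = 0 \<longleftrightarrow> l\<^sup>2 - l = \<phi> (\<Lambda>\<^sup>2 - \<Lambda>)"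
proof -
  have "g l \<Lambda> = (a0 + a2 * (\<Lambda>\<^sup>2 - \<Lambda>)) + (l\<^sup>2 - l) * (a1 + a3 * (\<Lambda>\<^sup>2 - \<Lambda>))"
    by (simp add: g_eq algebra_simps)
  thus ?thesis
    using denominator_nz[OF parabola_unit_interval[OF assms]]
    unfolding \<phi>_def minus_divide_left by (simp only: eq_divide_eq) auto
qed

section \<open>Range of \<open>\<phi>\<close> on [-1/4, 0]\<close>

lemma phi_0: "\<phi> 0 = lstar\<^sup>2 - lstar"
  by (simp add: \<phi>_def lstar(2))

lemma phi_0_range: "\<phi> 0 \<in> {-1/4..<0}" "lstar \<noteq> 1/2 \<Longrightarrow> \<phi> 0 > -1/4"
proof -
  have "lstar * (1 - lstar) > 0" using lstar(1) by (intro mult_pos_pos) auto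
  moreover have "lstar\<^sup>2 - lstar = (lstar - 1/2)\<^sup>2 - 1/4"
    by (simp add: power2_eq_square algebra_simps)
  moreover have "lstar * (1 - lstar) = - (lstar\<^sup>2 - lstar)"
    by (simp add: power2_eq_square algebra_simps)
  moreover have "(lstar - 1/2)\<^sup>2 \<ge> 0" "lstar \<noteq> 1/2 \<Longrightarrow> (lstar - 1/2)\<^sup>2 > 0" by simp_all
  ultimately show "\<phi> 0 \<in> {-1/4..<0}" "lstar \<noteq> 1/2 \<Longrightarrow> \<phi> 0 > -1/4"
    unfolding phi_0 atLeastLessThan_iff by linarith+
qed

lemma phi_end: "\<phi> (-1/4) = - ((4 * a0 - a2) / (4 * a1 - a3))"
proof -
  have "4 * a1 - a3 \<noteq> 0" using denominator_nz[of "-1/4"] by simp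
  thus ?thesis using denominator_nz[of "-1/4"] by (simp add: \<phi>_def field_simps)
qed

text \<open>As the denominators share one sign, \<open>\<phi>\<close> is strictly monotone when
  \<open>a0 * a3 \<noteq> a1 * a2\<close> and constant otherwise.\<close>

lemma phi_diff:
  assumes "y \<in> {-1/4..0}" "z \<in> {-1/4..0}"
  shows "\<phi> y - \<phi> z = (a0 * a3 - a1 * a2) * (y - z) / ((a1 + a3 * y) * (a1 + a3 * z))"
  using denominator_nz[OF assms(1)] denominator_nz[OF assms(2)]
  by (simp add: \<phi>_def divide_simps) (simp add: algebra_simps)

text \<open>A product of this shape is nonpositive exactly when \<open>\<phi> y\<close> lies between
  the two end values. This form covers increasing and decreasing \<open>\<phi>\<close> at once,
  since the factor \<open>a0 * a3 - a1 * a2\<close> appears squared.\<close>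

lemma phi_between:
  assumes y: "y \<in> {-1/4..0}"
  shows "(\<phi> y - \<phi> 0) * (\<phi> y - \<phi> (-1/4)) \<le> 0"
    and "a0 * a3 \<noteq> a1 * a2 \<Longrightarrow> y \<in> {-1/4<..<0} \<Longrightarrow> (\<phi> y - \<phi> 0) * (\<phi> y - \<phi> (-1/4)) < 0"
proof -
  define d where "d = (a1 + a3 * y) * (a1 + a3 * 0) * ((a1 + a3 * y) * (a1 + a3 * (-1/4)))"
  have ends: "0 \<in> {-1/4..0::real}" "-1/4 \<in> {-1/4..0::real}" by auto
  have d: "d > 0" unfolding d_def
    by (intro mult_pos_pos[of "_ * _"] denominators_same_sign y ends)
  have eq: "(\<phi> y - \<phi> 0) * (\<phi> y - \<phi> (-1/4)) = (a0 * a3 - a1 * a2)\<^sup>2 * (y * (y + 1/4)) / d"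
    unfolding phi_diff[OF y ends(1)] phi_diff[OF y ends(2)] d_def
    by (simp add: power2_eq_square)
  have "y * (y + 1/4) \<le> 0" using y by (intro mult_nonpos_nonneg) auto
  thus "(\<phi> y - \<phi> 0) * (\<phi> y - \<phi> (-1/4)) \<le> 0"
    unfolding eq by (intro divide_nonpos_pos[OF mult_nonneg_nonpos[OF zero_le_power2] d])
  assume "a0 * a3 \<noteq> a1 * a2" "y \<in> {-1/4<..<0}"
  hence "(a0 * a3 - a1 * a2)\<^sup>2 > 0" "y * (y + 1/4) < 0" by (auto intro: mult_neg_pos)
  thus "(\<phi> y - \<phi> 0) * (\<phi> y - \<phi> (-1/4)) < 0"
    unfolding eq by (intro divide_neg_pos[OF mult_pos_neg d])
qed

lemma phi_range:
  assumes "\<phi> (-1/4) \<in> {-1/4..0}" "y \<in> {-1/4..0}"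
  shows "\<phi> y \<in> {-1/4..0}"
proof (rule ccontr)
  assume "\<phi> y \<notin> {-1/4..0}"
  hence "\<phi> y < \<phi> 0 \<and> \<phi> y < \<phi> (-1/4) \<or> \<phi> y > \<phi> 0 \<and> \<phi> y > \<phi> (-1/4)"
    using phi_0_range(1) assms(1) by auto
  hence "(\<phi> y - \<phi> 0) * (\<phi> y - \<phi> (-1/4)) > 0"
    by (auto intro: mult_pos_pos mult_neg_neg)
  thus False using phi_between(1)[OF assms(2)] by simp
qed

text \<open>The value -1/4 is the vertex of the parabola, where the two roots coincide. Strict
  monotonicity keeps it away from interior points, and it is attained at y = 0 only for
  \<open>lstar = 1/2\<close>.\<close>

lemma phi_gt:
  assumes "\<phi> (-1/4) \<in> {-1/4<..0}" "y \<in> {-1/4..0}" "a0 * a3 \<noteq> a1 * a2" "lstar \<noteq> 1/2 \<or> y \<noteq> 0"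
  shows "\<phi> y > -1/4"
proof (cases "y = 0 \<or> y = -1/4")
  case True
  thus ?thesis using phi_0_range(2) assms by auto
next
  case False
  hence "(\<phi> y - \<phi> 0) * (\<phi> y - \<phi> (-1/4)) < 0"
    using phi_between(2)[OF assms(2,3)] assms(2) by auto
  hence "\<phi> y > \<phi> 0 \<or> \<phi> y > \<phi> (-1/4)"
    by (auto simp: mult_less_0_iff)
  thus ?thesis using phi_0_range(1) assms(1) by auto
qed

text \<open>The smaller root is chosen because \<open>lstar\<close> lies in (0, 1/2]; the other root
  is \<open>1 - low \<Lambda>\<close>.\<close>

definition "low \<Lambda> = 1/2 - sqrt (1/4 + \<phi> (\<Lambda>\<^sup>2 - \<Lambda>))"

lemma solvable_iff:
  "(\<exists>l\<in>{0..1}. l\<^sup>2 - l = q) \<longleftrightarrow> q \<in> {-1/4..0}" for q :: real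
proof
  assume q: "q \<in> {-1/4..0}"
  hence "sqrt (1/4 + q) \<le> sqrt ((1/2)\<^sup>2)" by (intro real_sqrt_le_mono) (simp add: power2_eq_square)
  moreover have "sqrt (1/4 + q) \<ge> 0" using q by simp
  ultimately have "1/2 - sqrt (1/4 + q) \<in> {0..1}" by (simp del: real_sqrt_ge_0_iff)
  moreover have "(1/2 - sqrt (1/4 + q))\<^sup>2 - (1/2 - sqrt (1/4 + q)) = q"
    using q by (simp add: power2_diff power2_eq_square[of "1/2"])
  ultimately show "\<exists>l\<in>{0..1}. l\<^sup>2 - l = q" by blast
qed (use parabola_unit_interval in blast)

lemma low_properties:
  assumes "\<phi> (\<Lambda>\<^sup>2 - \<Lambda>) \<in> {-1/4..0}"
  shows "low \<Lambda> \<in> {0..1/2}" "(low \<Lambda>)\<^sup>2 - low \<Lambda> = \<phi> (\<Lambda>\<^sup>2 - \<Lambda>)"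
    "\<phi> (\<Lambda>\<^sup>2 - \<Lambda>) > -1/4 \<Longrightarrow> low \<Lambda> \<noteq> 1/2"
proof -
  let ?q = "\<phi> (\<Lambda>\<^sup>2 - \<Lambda>)"
  have "sqrt (1/4 + ?q) \<le> sqrt ((1/2)\<^sup>2)"
    using assms by (intro real_sqrt_le_mono) (simp add: power2_eq_square)
  thus "low \<Lambda> \<in> {0..1/2}" using assms by (simp add: low_def)
  show "(low \<Lambda>)\<^sup>2 - low \<Lambda> = ?q"
    using assms by (simp add: low_def power2_diff power2_eq_square[of "1/2"])
  show "?q > -1/4 \<Longrightarrow> low \<Lambda> \<noteq> 1/2" by (simp add: low_def)
qed

lemma low_ends: "low 0 = lstar" "low 1 = lstar"
proof -
  have "1/4 + (lstar\<^sup>2 - lstar) = (1/2 - lstar)\<^sup>2"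
    by (simp add: power2_eq_square algebra_simps)
  hence "sqrt (1/4 + \<phi> 0) = 1/2 - lstar"
    unfolding phi_0 using lstar(1) by simp
  thus "low 0 = lstar" "low 1 = lstar" by (simp_all add: low_def)
qed

section \<open>Branches of zeros and their meeting\<close>

lemma continuous_phi: "continuous_on {0..1} (\<lambda>\<Lambda>. \<phi> (\<Lambda>\<^sup>2 - \<Lambda>))"
  unfolding \<phi>_def using denominator_nz[OF parabola_unit_interval]
  by (intro continuous_intros) auto

lemma zero_branch_low:
  assumes "S \<subseteq> {0..1}" "\<And>\<Lambda>. \<Lambda> \<in> S \<Longrightarrow> \<phi> (\<Lambda>\<^sup>2 - \<Lambda>) \<in> {-1/4..0}"
  shows "zero_branch g S low" "zero_branch g S (\<lambda>\<Lambda>. 1 - low \<Lambda>)"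
proof -
  have cont: "continuous_on S low"
    unfolding low_def
    by (intro continuous_intros continuous_on_subset[OF continuous_phi assms(1)])
  have low: "low \<Lambda> \<in> {0..1} \<and> g (low \<Lambda>) \<Lambda> = 0 \<and> g (1 - low \<Lambda>) \<Lambda> = 0" if "\<Lambda> \<in> S" for \<Lambda>
  proof -
    have L: "\<Lambda> \<in> {0..1}" using that assms(1) by blast
    note q = low_properties[OF assms(2)[OF that]]
    have "(1 - low \<Lambda>)\<^sup>2 - (1 - low \<Lambda>) = (low \<Lambda>)\<^sup>2 - low \<Lambda>"
      by (subst parabola_eq_iff) simp
    thus ?thesis using q unfolding zero_iff[OF L] by auto
  qed
  show "zero_branch g S low" "zero_branch g S (\<lambda>\<Lambda>. 1 - low \<Lambda>)"
    using low by (auto simp: zero_branch_def intro!: continuous_intros cont)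
qed

text \<open>For \<open>lstar \<noteq> 1/2\<close> the value \<open>\<phi> 0\<close> is interior to
  [-1/4, 0], and continuity keeps nearby values there. For \<open>lstar = 1/2\<close> it sits on the
  boundary, where this argument fails.\<close>

lemma phi_near_ends:
  assumes "lstar \<noteq> 1/2"
  obtains \<epsilon> where "0 < \<epsilon>" "\<epsilon> \<le> 1"
    "\<And>\<Lambda>. \<Lambda> \<in> {0..\<epsilon>} \<Longrightarrow> \<phi> (\<Lambda>\<^sup>2 - \<Lambda>) \<in> {-1/4..0}"
    "\<And>\<Lambda>. \<Lambda> \<in> {1-\<epsilon>..1} \<Longrightarrow> \<phi> (\<Lambda>\<^sup>2 - \<Lambda>) \<in> {-1/4..0}"
proof -
  define e where "e = min (\<phi> 0 + 1/4) (- \<phi> 0)"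
  have "e > 0" using phi_0_range assms by (auto simp: e_def)
  then obtain d where d: "d > 0"
    "\<And>\<Lambda>. \<Lambda> \<in> {0..1} \<Longrightarrow> dist \<Lambda> 0 < d \<Longrightarrow> dist (\<phi> (\<Lambda>\<^sup>2 - \<Lambda>)) (\<phi> (0\<^sup>2 - 0)) < e"
    using continuous_phi[unfolded continuous_on_iff, rule_format, of 0 e] by auto
  define \<epsilon> where "\<epsilon> = min 1 (d / 2)"
  have *: "\<phi> (\<Lambda>\<^sup>2 - \<Lambda>) \<in> {-1/4..0}" if "\<Lambda> \<in> {0..\<epsilon>}" for \<Lambda>
    using d(2)[of \<Lambda>] that d(1) by (auto simp: \<epsilon>_def dist_real_def e_def)
  have "\<phi> (\<Lambda>\<^sup>2 - \<Lambda>) \<in> {-1/4..0}" if "\<Lambda> \<in> {1-\<epsilon>..1}" for \<Lambda>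
  proof -
    have "(1 - \<Lambda>)\<^sup>2 - (1 - \<Lambda>) = \<Lambda>\<^sup>2 - \<Lambda>" by (subst parabola_eq_iff) simp
    moreover have "1 - \<Lambda> \<in> {0..\<epsilon>}" using that by auto
    ultimately show ?thesis using *[of "1 - \<Lambda>"] by (simp only:)
  qed
  with * that[of \<epsilon>] d(1) show thesis by (auto simp: \<epsilon>_def)
qed

lemma branches_from_ends:
  assumes "lstar \<noteq> 1/2"
  shows "branch_from_0 g lstar" "branch_from_1 g lstar"
    "branch_from_0 g (1 - lstar)" "branch_from_1 g (1 - lstar)"
proof -
  obtain \<epsilon> where \<epsilon>: "0 < \<epsilon>" "\<epsilon> \<le> 1"
    and near: "\<And>\<Lambda>. \<Lambda> \<in> {0..\<epsilon>} \<Longrightarrow> \<phi> (\<Lambda>\<^sup>2 - \<Lambda>) \<in> {-1/4..0}"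
      "\<And>\<Lambda>. \<Lambda> \<in> {1-\<epsilon>..1} \<Longrightarrow> \<phi> (\<Lambda>\<^sup>2 - \<Lambda>) \<in> {-1/4..0}"
    using phi_near_ends[OF assms] by blast
  have "{0..\<epsilon>} \<subseteq> {0..1}" "{1-\<epsilon>..1} \<subseteq> {0..1}" using \<epsilon> by auto
  note z = zero_branch_low[OF this(1) near(1)] zero_branch_low[OF this(2) near(2)]
  show "branch_from_0 g lstar" "branch_from_1 g lstar"
    "branch_from_0 g (1 - lstar)" "branch_from_1 g (1 - lstar)"
    unfolding branch_from_0_def branch_from_1_def using z \<epsilon> low_ends by metis+
qed

text \<open>Necessity is seen at \<Lambda> = 1/2. Sufficiency holds because all values of
  \<open>\<phi>\<close> lie between its end values, and \<open>\<phi> 0\<close> is already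
  admissible.\<close>

lemma solvable_everywhere_iff:
  "(\<forall>\<Lambda>\<in>{0..1}. \<exists>l\<in>{0..1}. l\<^sup>2 - l = \<phi> (\<Lambda>\<^sup>2 - \<Lambda>)) \<longleftrightarrow> \<phi> (-1/4) \<in> {-1/4..0}"
proof
  assume "\<forall>\<Lambda>\<in>{0..1}. \<exists>l\<in>{0..1}. l\<^sup>2 - l = \<phi> (\<Lambda>\<^sup>2 - \<Lambda>)"
  hence "\<phi> ((1/2)\<^sup>2 - 1/2) \<in> {-1/4..0}" unfolding solvable_iff by auto
  thus "\<phi> (-1/4) \<in> {-1/4..0}" by (simp add: power2_eq_square)
qed (use phi_range parabola_unit_interval in \<open>unfold solvable_iff, blast\<close>)

lemma branches_meet_iff:
  assumes k: "k \<in> {lstar, 1 - lstar}"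
  shows "branches_meet g k \<longleftrightarrow> \<phi> (-1/4) \<in> {-1/4..0}"
proof
  assume "branches_meet g k"
  then obtain c f0 f1 where "zero_branch g {0..c} f0" "zero_branch g {c..1} f1" "c \<in> {0..1}"
    unfolding branches_meet_def by blast
  \<comment> \<open>The two branches together cover [0, 1], so meeting forces solvability for every
    \<Lambda>.\<close>
  hence "(if \<Lambda> \<le> c then f0 \<Lambda> else f1 \<Lambda>) \<in> {0..1} \<and> g (if \<Lambda> \<le> c then f0 \<Lambda> else f1 \<Lambda>) \<Lambda> = 0"
    if "\<Lambda> \<in> {0..1}" for \<Lambda>
    using that by (auto simp: zero_branch_def)
  hence "\<exists>l\<in>{0..1}. g l \<Lambda> = 0" if "\<Lambda> \<in> {0..1}" for \<Lambda>
    using that by blast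
  thus "\<phi> (-1/4) \<in> {-1/4..0}"
    unfolding solvable_everywhere_iff[symmetric] using zero_iff by blast
next
  assume "\<phi> (-1/4) \<in> {-1/4..0}"
  hence "zero_branch g {0..1} low" "zero_branch g {0..1} (\<lambda>\<Lambda>. 1 - low \<Lambda>)"
    using zero_branch_low[of "{0..1}"] phi_range parabola_unit_interval by blast+
  moreover have "zero_branch g {1..1} f" if "zero_branch g {0..1} f" for f
    using that by (auto simp: zero_branch_def)
  ultimately have "\<exists>f. zero_branch g {0..1} f \<and> zero_branch g {1..1} f \<and> f 0 = k \<and> f 1 = k"
    using k low_ends by (metis insertE singletonD)
  thus "branches_meet g k"
    \<comment> \<open>The first branch runs all the way to \<Lambda> = 1, and the second shrinks to
      that point.\<close>
    unfolding branches_meet_def by (intro bexI[of _ 1]) auto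
qed

lemma card_zeros:
  assumes "\<phi> (-1/4) \<in> {-1/4<..0}" "\<Lambda> \<in> {0..1}" "a0 * a3 \<noteq> a1 * a2" "lstar \<noteq> 1/2 \<or> \<Lambda> \<notin> {0, 1}"
  shows "card {l\<in>{0..1}. g l \<Lambda> = 0} = 2"
proof -
  have y: "\<Lambda>\<^sup>2 - \<Lambda> \<in> {-1/4..0}" by (rule parabola_unit_interval[OF assms(2)])
  have "\<Lambda>\<^sup>2 - \<Lambda> = 0 \<longleftrightarrow> \<Lambda> \<in> {0, 1}" using parabola_eq_iff[of \<Lambda> 0] by simp
  hence gt: "\<phi> (\<Lambda>\<^sup>2 - \<Lambda>) > -1/4" using phi_gt[OF assms(1) y assms(3)] assms(4) by blast
  have q: "\<phi> (\<Lambda>\<^sup>2 - \<Lambda>) \<in> {-1/4..0}" using phi_range[OF _ y] assms(1) by simp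
  note low = low_properties[OF q]
  have "{l\<in>{0..1}. g l \<Lambda> = 0} = {low \<Lambda>, 1 - low \<Lambda>}"
    unfolding zero_iff[OF assms(2)] low(2)[symmetric] parabola_eq_iff using low(1) by auto
  moreover have "low \<Lambda> \<noteq> 1 - low \<Lambda>" using low(3)[OF gt] by simp
  ultimately show ?thesis by (simp add: card_2_iff)
qed

lemma ends_zero_set:
  assumes "\<Lambda> \<in> {0, 1}"
  shows "{l. l\<^sup>2 - l = \<phi> (\<Lambda>\<^sup>2 - \<Lambda>)} = {lstar, 1 - lstar}"
proof -
  have "\<phi> (\<Lambda>\<^sup>2 - \<Lambda>) = lstar\<^sup>2 - lstar" using assms phi_0 by auto
  thus ?thesis by (auto simp: parabola_eq_iff)
qed

lemma constant_phi:
  assumes "a0 * a3 = a1 * a2" "y \<in> {-1/4..0}"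
  shows "\<phi> y = lstar\<^sup>2 - lstar"
  using phi_diff[OF assms(2), of 0] assms(1) by (simp add: phi_0)

lemma end_condition:
  "\<phi> (-1/4) \<in> {-1/4..0} \<longleftrightarrow>
     0 \<le> (4 * a0 - a2) / (4 * a1 - a3) \<and> (4 * a0 - a2) / (4 * a1 - a3) \<le> 1/4"
  "\<phi> (-1/4) \<in> {-1/4<..0} \<longleftrightarrow>
     0 \<le> (4 * a0 - a2) / (4 * a1 - a3) \<and> (4 * a0 - a2) / (4 * a1 - a3) \<le> 1/4
       \<and> (4 * a0 - a2) / (4 * a1 - a3) \<noteq> 1/4"
proof -
  have "- r \<in> {-1/4..0} \<longleftrightarrow> 0 \<le> r \<and> r \<le> 1/4"
    "- r \<in> {-1/4<..0} \<longleftrightarrow> 0 \<le> r \<and> r \<le> 1/4 \<and> r \<noteq> 1/4" for r :: real by auto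
  note r = this[of "(4 * a0 - a2) / (4 * a1 - a3)"]
  show "\<phi> (-1/4) \<in> {-1/4..0} \<longleftrightarrow>
     0 \<le> (4 * a0 - a2) / (4 * a1 - a3) \<and> (4 * a0 - a2) / (4 * a1 - a3) \<le> 1/4"
    unfolding phi_end by (rule r(1))
  show "\<phi> (-1/4) \<in> {-1/4<..0} \<longleftrightarrow>
     0 \<le> (4 * a0 - a2) / (4 * a1 - a3) \<and> (4 * a0 - a2) / (4 * a1 - a3) \<le> 1/4
       \<and> (4 * a0 - a2) / (4 * a1 - a3) \<noteq> 1/4"
    unfolding phi_end by (rule r(2))
qed

end

text \<open>The guards \<open>lstar \<noteq> 1/2\<close> concern the double root: for
  \<open>lstar = 1/2\<close> the two zeros at \<Lambda> = 0 and at \<Lambda> = 1 coincide.\<close>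

theorem mainTheorem2:
  fixes \<alpha> \<beta> \<gamma> :: real
    and A B A' B' :: variant
    and UA UB UA' UB' :: "real^3^3"
    and R_AB R_A'B' R_AA' R_BB' :: "real^3^3"
    and b_AB b_A'B' b_AA' b_BB' n_AB n_A'B' n_AA' n_BB' :: "real^3"
    and M :: "real \<Rightarrow> real \<Rightarrow> real^3^3"
    and g :: "real \<Rightarrow> real \<Rightarrow> real"
    and a0 a1 a2 a3 lstar :: real
  assumes params: "\<alpha> > 0" "\<beta> > 0" "\<gamma> > 0" "\<alpha> \<noteq> \<gamma>"
    and axes: "distinguished_axis A \<noteq> distinguished_axis B"
    and counterparts: "compound_counterpart A A'" "compound_counterpart B B'"
    and U_eq: "UA = variant_matrix \<alpha> \<beta> \<gamma> A" "UB = variant_matrix \<alpha> \<beta> \<gamma> B"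
      "UA' = variant_matrix \<alpha> \<beta> \<gamma> A'" "UB' = variant_matrix \<alpha> \<beta> \<gamma> B'"
    and twin_AB: "is_type_II_twin \<alpha> \<beta> \<gamma> A B R_AB b_AB n_AB"
    and twin_A'B': "is_type_II_twin \<alpha> \<beta> \<gamma> A' B' R_A'B' b_A'B' n_A'B'"
    and twin_AA': "is_twin UA UA' R_AA' b_AA' n_AA'"
    and twin_BB': "is_twin UB UB' R_BB' b_BB' n_BB'"
    and normals: "n_AA' = n_BB'"
    and rotations: "R_AB ** R_BB' = R_AA' ** R_A'B'"
    and M_eq: "\<And>l \<Lambda>. M l \<Lambda> =
        (1 - \<Lambda>) *\<^sub>R ((1 - l) *\<^sub>R UA + l *\<^sub>R (R_AB ** UB))
        + \<Lambda> *\<^sub>R (R_AA' ** ((1 - l) *\<^sub>R UA' + l *\<^sub>R (R_A'B' ** UB')))"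
    and g_eq: "\<And>l \<Lambda>. g l \<Lambda> = det (transpose (M l \<Lambda>) ** M l \<Lambda> - mat 1)"
    and a_eq: "a0 = const_a0 UA" "a1 = const_a12 UA b_AB n_AB" "a2 = const_a12 UA b_AA' n_AA'"
      "a3 = const_a3 UA b_AB n_AB b_AA' n_AA'"
    and a3_nz: "a3 \<noteq> 0"
    and ratio: "a1 / a3 \<notin> {0..1/4}"
    and lstar: "lstar \<in> {0<..1/2}" "lstar\<^sup>2 - lstar = - (a0 / a1)"
  shows "a1 \<noteq> 0
    \<and> (\<forall>l\<in>{0..1}. \<forall>\<Lambda>\<in>{0..1}. g l \<Lambda> = 0 \<longleftrightarrow>
          l\<^sup>2 - l = - ((a0 + a2 * (\<Lambda>\<^sup>2 - \<Lambda>)) / (a1 + a3 * (\<Lambda>\<^sup>2 - \<Lambda>))))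
    \<and> (\<forall>\<Lambda>\<in>{0, 1}. {l. l\<^sup>2 - l = - ((a0 + a2 * (\<Lambda>\<^sup>2 - \<Lambda>)) / (a1 + a3 * (\<Lambda>\<^sup>2 - \<Lambda>)))}
          = {lstar, 1 - lstar})
    \<and> (\<forall>l\<in>{0..1}. \<forall>\<Lambda>\<in>{0..1}. g (1 - l) \<Lambda> = g l \<Lambda>)
    \<and> g lstar 0 = 0 \<and> g lstar 1 = 0 \<and> g (1 - lstar) 0 = 0 \<and> g (1 - lstar) 1 = 0
    \<and> (lstar \<noteq> 1/2 \<longrightarrow>
          branch_from_0 g lstar \<and> branch_from_1 g lstar \<and>
          branch_from_0 g (1 - lstar) \<and> branch_from_1 g (1 - lstar))
    \<and> (a0 * a3 \<noteq> a1 * a2 \<longrightarrow>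
          ((\<forall>\<Lambda>\<in>{0..1}. \<exists>l\<in>{0..1}.
              l\<^sup>2 - l = - ((a0 + a2 * (\<Lambda>\<^sup>2 - \<Lambda>)) / (a1 + a3 * (\<Lambda>\<^sup>2 - \<Lambda>))))
            \<longleftrightarrow> 0 \<le> (4 * a0 - a2) / (4 * a1 - a3) \<and> (4 * a0 - a2) / (4 * a1 - a3) \<le> 1/4)
        \<and> (branches_meet g lstar
            \<longleftrightarrow> 0 \<le> (4 * a0 - a2) / (4 * a1 - a3) \<and> (4 * a0 - a2) / (4 * a1 - a3) \<le> 1/4)
        \<and> (branches_meet g (1 - lstar)
            \<longleftrightarrow> 0 \<le> (4 * a0 - a2) / (4 * a1 - a3) \<and> (4 * a0 - a2) / (4 * a1 - a3) \<le> 1/4)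
        \<and> (0 \<le> (4 * a0 - a2) / (4 * a1 - a3) \<and> (4 * a0 - a2) / (4 * a1 - a3) \<le> 1/4
            \<and> (4 * a0 - a2) / (4 * a1 - a3) \<noteq> 1/4
            \<longrightarrow> (\<forall>\<Lambda>\<in>{0..1}. lstar \<noteq> 1/2 \<or> \<Lambda> \<notin> {0, 1} \<longrightarrow>
                  card {l\<in>{0..1}. g l \<Lambda> = 0} = 2)))
    \<and> (a0 * a3 = a1 * a2 \<longrightarrow>
          (\<forall>\<Lambda>\<in>{0..1}. g lstar \<Lambda> = 0 \<and> g (1 - lstar) \<Lambda> = 0))"
proof -
  have AB: "rotation_matrix R_AB" "b_AB \<noteq> 0" "R_AB ** UB = UA + b_AB \<odot> n_AB"
    using twin_AB by (auto simp: is_type_II_twin_def is_twin_def U_eq algebra_simps)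
  have AA': "rotation_matrix R_AA'" "norm n_AA' = 1" "R_AA' ** UA' = UA + b_AA' \<odot> n_AA'"
    using twin_AA' by (auto simp: is_twin_def algebra_simps)
  have BB': "rotation_matrix R_BB'" "R_BB' ** UB' = UB + b_BB' \<odot> n_AA'"
    using twin_BB' normals by (auto simp: is_twin_def algebra_simps)
  obtain p c where p: "twin_rotation_axis \<alpha> \<beta> \<gamma> A B p" and b: "b_AB = c *\<^sub>R (UA *v p)"
    using twin_AB by (auto simp: is_type_II_twin_def U_eq)
  \<comment> \<open>The common compound normal is orthogonal to both distinguished axes, hence also
    to the Type-II axis \<open>p\<close>, which lies in their plane.\<close>
  have nA: "n_AA' $ distinguished_axis A = 0"
    using twin_normal_distinguished_axis[OF params(1,3,4) counterparts(1)] twin_AA' U_eq by blast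
  have nB: "n_AA' $ distinguished_axis B = 0"
    using twin_normal_distinguished_axis[OF params(1,3,4) counterparts(2)] twin_BB' U_eq normals by blast
  note p = twin_rotation_axis_properties[OF p nA nB]
  have UB: "UB = half_turn p ** UA ** half_turn p" using p(3) U_eq by simp
  have UA': "UA' = half_turn n_AA' ** UA ** half_turn n_AA'"
    using compound_counterpart_half_turn[OF counterparts(1) AA'(2) axes nA nB] U_eq by simp
  have UB': "UB' = half_turn n_AA' ** UB ** half_turn n_AA'"
    using compound_counterpart_half_turn[OF counterparts(2) AA'(2) axes[symmetric] nB nA] U_eq by simp
  have UA: "transpose UA = UA" by (simp add: U_eq transpose_variant_matrix)
  have "det UA \<noteq> 0" using params by (simp add: U_eq det_variant_matrix)
  then obtain V where V: "UA ** V = mat 1"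
    using invertible_det_nz[of UA] by (auto simp: invertible_def)
  interpret tw: crossing_twins UA V R_AB R_AA' b_AB n_AB b_AA' n_AA' p c
    using UA V p(1,2) AA' AB b by unfold_locales (simp_all flip: UB UA')
  have shear: "R_AB *v b_BB' = b_AA' - tw.\<eta> *\<^sub>R b_AB"
    using tw.conjugate_compound_shear[OF UB BB'(1)] BB'(2) by (simp flip: UB')
  \<comment> \<open>The compatibility of the rotations reaches the fourth corner of \<open>M\<close>
    through \<open>UB\<close> instead of \<open>UA'\<close>: it becomes
    \<open>R_AB ** (UB + b_BB' \<odot> n_AA')\<close>, so the twin of A' and B' drops out.\<close>
  have mv: "R_AB *v (UB *v x) = UA *v x + (n_AB \<bullet> x) *\<^sub>R b_AB"
    "R_AA' *v (UA' *v x) = UA *v x + (n_AA' \<bullet> x) *\<^sub>R b_AA'"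
    "R_BB' *v (UB' *v x) = UB *v x + (n_AA' \<bullet> x) *\<^sub>R b_BB'"
    "R_AA' *v (R_A'B' *v x) = R_AB *v (R_BB' *v x)" for x
    using AB(3) AA'(3) BB'(2) rotations
    by (simp_all add: matrix_vector_mul_assoc mult_vec_simps(2) outer_mult_vec)
  have "M l \<Lambda> = tw.M l \<Lambda>" for l \<Lambda>
    unfolding M_eq matrix_eq tw.M_mult_vec
    by (simp add: mult_vec_simps mv shear algebra_simps)
  hence "g l \<Lambda> = tw.g l \<Lambda>" for l \<Lambda> by (simp add: g_eq tw.g_def)
  hence form: "g l \<Lambda> = a0 + a1 * (l\<^sup>2 - l) + a2 * (\<Lambda>\<^sup>2 - \<Lambda>) + a3 * (l\<^sup>2 - l) * (\<Lambda>\<^sup>2 - \<Lambda>)" for l \<Lambda>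
    using tw.g_form[of l \<Lambda>] a_eq by simp
  interpret z: bilinear_zero_set g a0 a1 a2 a3 lstar
    by unfold_locales (fact form a3_nz ratio lstar)+
  have refl: "g (1 - l) \<Lambda> = g l \<Lambda>" for l \<Lambda>
  proof -
    have "(1 - l)\<^sup>2 - (1 - l) = l\<^sup>2 - l" by (subst parabola_eq_iff) simp
    thus ?thesis unfolding form by (simp only:)
  qed
  have ends: "g lstar 0 = 0" "g lstar 1 = 0" "g (1 - lstar) 0 = 0" "g (1 - lstar) 1 = 0"
    using z.zero_iff[of 0 lstar] z.zero_iff[of 1 lstar] z.phi_0 by (simp_all add: refl)
  have const: "g lstar \<Lambda> = 0 \<and> g (1 - lstar) \<Lambda> = 0" if "a0 * a3 = a1 * a2" "\<Lambda> \<in> {0..1}" for \<Lambda>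
    using z.zero_iff[OF that(2)] z.constant_phi[OF that(1) parabola_unit_interval[OF that(2)]] refl
    by metis
  show ?thesis
    unfolding z.\<phi>_def[symmetric] z.end_condition[symmetric] z.solvable_everywhere_iff
    using z.a1_nz z.zero_iff z.ends_zero_set refl ends z.branches_from_ends z.branches_meet_iff
      z.card_zeros const z.end_condition(2)
    by simp
qed

end
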